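(* For each choice of sign $\varepsilon\in\{+1,-1\}$, define $$u_1(z)=[\,\varepsilon(z+6i):iz\,],\qquad u_2(z)=[\,\varepsilon(z+6i):iz:\varepsilon(z-6i)\,].$$ Then the quilt $\underline{u}=(u_1,u_2)$ consists of holomorphic maps $$u_1\colon\{z\in\mathbb{C}:\operatorname{Im}z\ge1\}\to\mathbb{CP}^1,\qquad u_2\colon\{z\in\mathbb{C}:0\le\operatorname{Im}z\le1\}\to\mathbb{CP}^2$$ satisfying the seam and boundary conditions $$\bigl(u_1(x+i),u_2(x+i)\bigr)\in\Lambda_{S^1}\quad\text{and}\quad u_2(x)\in L_{\mathrm{AC}}\qquad\text{for all }x\in\mathbb{R},$$ and having total symplectic area $\int_{\operatorname{Im}z\ge1}u_1^*\omega_{\mathbb{CP}^1}+\int_{0\le\operatorname{Im}z\le1}u_2^*\omega_{\mathbb{CP}^2}$ equal to one-fourth of the symplectic area of $\mathbb{CP}^1$ (hence quilted Maslov index $1$).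
   Context: For $n=1,2$, $\omega_{\mathbb{CP}^n}$ is the Fubini--Study form normalized to have monotonicity constant $1$ (i.e. $[\omega_{\mathbb{CP}^n}]=c_1(T\mathbb{CP}^n)$); in an affine chart with coordinates $\underline{z}=(z_1,\dots,z_n)$ it is $$\omega_{\mathbb{CP}^n}=\frac{(n+1)i}{2\pi(1+|\underline{z}|^2)^2}\Bigl(\sum_{1\le k\le n}(1+|\underline{z}|^2-|z_k|^2)\,dz_k\wedge d\overline{z_k}-\sum_{j\ne k}\overline{z_j}z_k\,dz_j\wedge d\overline{z_k}\Bigr).$$ The area of $\mathbb{CP}^1$ refers to $\omega_{\mathbb{CP}^1}$. The circle acts on $\mathbb{CP}^2$ by $e^{i\lambda}\cdot[X:Y:Z]=[X:Y:e^{i\lambda}Z]$ with moment map $\mu[X:Y:Z]=-\frac12\frac{|Z|^2}{|X|^2+|Y|^2+|Z|^2}$. The symplectic quotient at level $-\frac16$ is $\mathbb{CP}^1$ with the form $\omega_{\mathbb{CP}^1}$, and the associated Lagrangian correspondence from $\mathbb{CP}^1$ to $\mathbb{CP}^2$ is $$\Lambda_{S^1}=\{([X:Y],[X:Y:Z]) : 2|Z|^2=|X|^2+|Y|^2\}\subset(\mathbb{CP}^1)^-\times\mathbb{CP}^2.$$ The Lagrangian $L_{\mathrm{AC}}\subset\mathbb{CP}^2$ is $$L_{\mathrm{AC}}=\{[A+iB:i\sqrt2\,C:A-iB] : A,B,C\in\mathbb{R},\ |A|^2+|B|^2+|C|^2=1\}.$$ The quilted Maslov index of such a quilted disk is, by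 monotonicity, twice its total symplectic area. *)

theory Defs
  imports "HOL-Analysis.Analysis"
begin

section \<open>Complex projective space\<close>

definition proj_rel :: "complex^'n \<Rightarrow> complex^'n \<Rightarrow> bool" where
  "proj_rel v w \<longleftrightarrow> v \<noteq> 0 \<and> w \<noteq> 0 \<and> (\<exists>c. c \<noteq> 0 \<and> w = c *s v)"

lemma part_equivp_proj_rel: "part_equivp proj_rel"
proof (rule part_equivpI)
  show "\<exists>v :: complex^'n. proj_rel v v"
    by (rule exI[of _ "vec 1"]) (auto simp: proj_rel_def vec_eq_iff intro!: exI[of _ 1])
  show "symp (proj_rel :: complex^'n \<Rightarrow> _)"
  proof (rule sympI)
    fix v w :: "complex^'n"
    assume "proj_rel v w"
    then obtain c where "v \<noteq> 0" "w \<noteq> 0" "c \<noteq> 0" "w = c *s v"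
      by (auto simp: proj_rel_def)
    then show "proj_rel w v"
      by (auto simp: proj_rel_def intro!: exI[of _ "1 / c"])
  qed
  show "transp (proj_rel :: complex^'n \<Rightarrow> _)"
  proof (rule transpI)
    fix u v w :: "complex^'n"
    assume "proj_rel u v" "proj_rel v w"
    then obtain c d where "u \<noteq> 0" "w \<noteq> 0" "c \<noteq> 0" "v = c *s u" "d \<noteq> 0" "w = d *s v"
      by (auto simp: proj_rel_def)
    then show "proj_rel u w"
      by (auto simp: proj_rel_def intro!: exI[of _ "d * c"])
  qed
qed

text \<open>The type \<open>'n cproj\<close> is the projective space of lines in \<open>complex^'n\<close>; its dimension is
  \<open>CARD('n) - 1\<close>.\<close>

quotient_type 'n cproj = "complex^'n::finite" / partial: proj_rel
  by (rule part_equivp_proj_rel)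

type_synonym cp1 = "2 cproj"
type_synonym cp2 = "3 cproj"

text \<open>The point \<open>proj v\<close> has homogeneous coordinates \<open>v\<close>. It is an unspecified point if \<open>v = 0\<close>.\<close>

definition proj :: "complex^'n \<Rightarrow> 'n cproj" where
  "proj = abs_cproj"

lemma proj_eq_iff:
  assumes "v \<noteq> 0" "w \<noteq> 0"
  shows "proj v = proj w \<longleftrightarrow> (\<exists>c. c \<noteq> 0 \<and> w = c *s v)"
proof -
  have r: "proj_rel v v" "proj_rel w w"
    using assms by (auto simp: proj_rel_def intro!: exI[of _ 1])
  have "proj v = proj w \<longleftrightarrow> proj_rel v w"
    unfolding proj_def using Quotient3_rel[OF Quotient3_cproj, of v w] r by blast
  then show ?thesis
    using assms by (simp add: proj_rel_def)
qed

text \<open>In the chart \<open>{p. in_chart i p}\<close> the affine coordinates of \<open>p\<close> are the components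
  \<open>chart i p $ k\<close> with \<open>k \<noteq> i\<close>; the redundant component \<open>chart i p $ i\<close> equals \<open>1\<close>.\<close>

lift_definition in_chart :: "'n::finite \<Rightarrow> 'n cproj \<Rightarrow> bool" is "\<lambda>i v. v $ i \<noteq> 0"
  by (auto simp: proj_rel_def)

lift_definition chart :: "'n::finite \<Rightarrow> 'n cproj \<Rightarrow> complex^'n" is "\<lambda>i v. (1 / v $ i) *s v"
  by (auto simp: proj_rel_def vec_eq_iff)

lemma in_chart_proj: "v \<noteq> 0 \<Longrightarrow> in_chart i (proj v) \<longleftrightarrow> v $ i \<noteq> 0"
  unfolding proj_def by (rule in_chart.abs_eq) (auto simp: proj_rel_def intro!: exI[of _ 1])

lemma chart_proj: "v \<noteq> 0 \<Longrightarrow> chart i (proj v) = (1 / v $ i) *s v"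
  unfolding proj_def by (rule chart.abs_eq) (auto simp: proj_rel_def intro!: exI[of _ 1])

text \<open>The \<open>openin\<close> condition, over all \<open>i\<close>, is continuity with respect to the charts; the set
  \<open>S\<close> need not be open (here it is a closed half-plane or strip).\<close>

definition cproj_holomorphic_on :: "(complex \<Rightarrow> 'n::finite cproj) \<Rightarrow> complex set \<Rightarrow> bool" where
  "cproj_holomorphic_on u S \<longleftrightarrow>
    (\<forall>i. openin (top_of_set S) {z\<in>S. in_chart i (u z)} \<and>
         (\<forall>k. (\<lambda>z. chart i (u z) $ k) holomorphic_on {z\<in>S. in_chart i (u z)}))"


section \<open>Fubini--Study form and symplectic area\<close>

text \<open>The value on tangent vectors \<open>\<xi>\<close>, \<open>\<eta>\<close> at the point with coordinates \<open>z\<close> in the \<open>i\<close>-th chart;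
  \<open>CARD('n)\<close> is the factor $n+1$, and \<open>w j k\<close> is \<open>dz\<^sub>j \<and> d(cnj z\<^sub>k)\<close> evaluated on \<open>(\<xi>, \<eta>)\<close>. The
  complex number under \<open>Re\<close> is real.\<close>

definition fs_form :: "'n::finite \<Rightarrow> complex^'n \<Rightarrow> complex^'n \<Rightarrow> complex^'n \<Rightarrow> real" where
  "fs_form i z \<xi> \<eta> =
    (let r = 1 + (\<Sum>k\<in>-{i}. (cmod (z $ k))\<^sup>2);
         w = (\<lambda>j k. \<xi> $ j * cnj (\<eta> $ k) - \<eta> $ j * cnj (\<xi> $ k))
     in Re (of_nat CARD('n) * \<i> / (2 * of_real pi * of_real r ^ 2) *
            ((\<Sum>k\<in>-{i}. of_real (r - (cmod (z $ k))\<^sup>2) * w k k)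
             - (\<Sum>j\<in>-{i}. \<Sum>k\<in>-{i,j}. cnj (z $ j) * z $ k * w j k))))"

text \<open>The density of the pullback of the Fubini--Study form with respect to \<open>dx \<and> dy\<close>. The forms in
  the different charts agree on overlaps, so the choice of \<open>i\<close> is immaterial.\<close>

definition fs_pullback :: "complex set \<Rightarrow> (complex \<Rightarrow> 'n::finite cproj) \<Rightarrow> complex \<Rightarrow> real" where
  "fs_pullback S u z =
    (let i = (SOME i. in_chart i (u z));
         D = frechet_derivative (\<lambda>w. chart i (u w)) (at z within S)
     in fs_form i (chart i (u z)) (D 1) (D \<i>))"

definition symplectic_area :: "complex set \<Rightarrow> (complex \<Rightarrow> 'n::finite cproj) \<Rightarrow> real" where
  "symplectic_area S u = integral S (fs_pullback S u)"

text \<open>The affine chart \<open>z \<mapsto> [1 : z]\<close> omits only one point of the projective line.\<close>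

definition cp1_area :: real where
  "cp1_area = symplectic_area UNIV (\<lambda>z. proj (vector [1, z]) :: cp1)"


section \<open>The Lagrangian and the Lagrangian correspondence\<close>

definition Lambda_S1 :: "(cp1 \<times> cp2) set" where
  "Lambda_S1 = {(proj (vector [X, Y]), proj (vector [X, Y, Z])) | X Y Z.
     (X, Y) \<noteq> (0, 0) \<and> 2 * (cmod Z)\<^sup>2 = (cmod X)\<^sup>2 + (cmod Y)\<^sup>2}"

definition L_AC :: "cp2 set" where
  "L_AC = {proj (vector [of_real A + \<i> * of_real B, \<i> * of_real (sqrt 2) * of_real C,
                         of_real A - \<i> * of_real B]) | A B C :: real.
     \<bar>A\<bar>\<^sup>2 + \<bar>B\<bar>\<^sup>2 + \<bar>C\<bar>\<^sup>2 = 1}"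


section \<open>Quilted Maslov index\<close>

definition upper_patch :: "complex set" where
  "upper_patch = {z. Im z \<ge> 1}"

definition lower_patch :: "complex set" where
  "lower_patch = {z. 0 \<le> Im z \<and> Im z \<le> 1}"

text \<open>A tangent vector of the projective space at \<open>proj v\<close> is represented by a vector \<open>\<xi>\<close> modulo
  multiples of \<open>v\<close>, namely as the velocity of \<open>proj (v + t \<xi>)\<close>. Accordingly, the tangent space
  of \<open>L\<close> is represented by the tangent space at \<open>v\<close> of the cone over \<open>L\<close>, which contains \<open>v\<close> and
  \<open>\<i> *s v\<close>.\<close>

definition cone_tangent :: "'n::finite cproj set \<Rightarrow> complex^'n \<Rightarrow> (complex^'n) set" where
  "cone_tangent L v = {\<xi>. \<exists>\<gamma> :: real \<Rightarrow> complex^'n.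
     \<gamma> 0 = v \<and> (\<gamma> has_vector_derivative \<xi>) (at 0) \<and>
     (\<forall>\<^sub>F t in nhds 0. \<gamma> t \<noteq> 0 \<and> proj (\<gamma> t) \<in> L)}"

definition cone_tangent2 ::
  "('m::finite cproj \<times> 'n::finite cproj) set \<Rightarrow> (complex^'m) \<times> (complex^'n) \<Rightarrow>
     ((complex^'m) \<times> (complex^'n)) set" where
  "cone_tangent2 \<Lambda> v = {\<xi>. \<exists>\<gamma> :: real \<Rightarrow> (complex^'m) \<times> (complex^'n).
     \<gamma> 0 = v \<and> (\<gamma> has_vector_derivative \<xi>) (at 0) \<and>
     (\<forall>\<^sub>F t in nhds 0. fst (\<gamma> t) \<noteq> 0 \<and> snd (\<gamma> t) \<noteq> 0 \<and>
        (proj (fst (\<gamma> t)), proj (snd (\<gamma> t))) \<in> \<Lambda>)}"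

text \<open>A continuous choice of homogeneous coordinates for \<open>u\<close> on \<open>S \<union> {\<infinity>}\<close>.\<close>

definition lifts :: "complex set \<Rightarrow> (complex \<Rightarrow> 'n::finite cproj) \<Rightarrow> (complex \<Rightarrow> complex^'n) \<Rightarrow> bool"
  where
  "lifts S u v \<longleftrightarrow> continuous_on S v \<and> (\<forall>z\<in>S. v z \<noteq> 0 \<and> u z = proj (v z)) \<and>
     (\<exists>l. l \<noteq> 0 \<and> (v \<longlongrightarrow> l) (inf at_infinity (principal S)))"

text \<open>A choice \<open>v\<close> of homogeneous coordinates trivialises the top exterior power of the cotangent space
  at \<open>proj v\<close> by the complex volume forms \<open>det (v, \<xi>)\<close> and \<open>det (v, \<xi>, \<eta>)\<close>, which are well defined
  modulo \<open>v\<close>. On \<open>(CP\<^sup>1)\<^sup>- \<times> CP\<^sup>2\<close>, whose first factor carries the opposite complex structure, the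
  volume form is the wedge product of the conjugate of the first with the second.\<close>

definition vol1 :: "complex^2 \<Rightarrow> complex^2 \<Rightarrow> complex" where
  "vol1 v \<xi> = det (vector [v, \<xi>] :: complex^2^2)"

definition vol2 :: "complex^3 \<Rightarrow> complex^3 \<Rightarrow> complex^3 \<Rightarrow> complex" where
  "vol2 v \<xi> \<eta> = det (vector [v, \<xi>, \<eta>] :: complex^3^3)"

definition vol12 :: "(complex^2) \<times> (complex^3) \<Rightarrow> (complex^2) \<times> (complex^3) \<Rightarrow>
    (complex^2) \<times> (complex^3) \<Rightarrow> (complex^2) \<times> (complex^3) \<Rightarrow> complex" where
  "vol12 v \<xi> \<eta> \<zeta> =
     cnj (vol1 (fst v) (fst \<xi>)) * vol2 (snd v) (snd \<eta>) (snd \<zeta>) +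
     cnj (vol1 (fst v) (fst \<eta>)) * vol2 (snd v) (snd \<zeta>) (snd \<xi>) +
     cnj (vol1 (fst v) (fst \<zeta>)) * vol2 (snd v) (snd \<xi>) (snd \<eta>)"

text \<open>The squared phase of the volume form on a real basis of the tangent space. It does not depend on
  the basis, since a real change of basis multiplies the volume by a nonzero real number.\<close>

definition squared_phase :: "cp2 set \<Rightarrow> complex^3 \<Rightarrow> complex \<Rightarrow> bool" where
  "squared_phase L v \<rho> \<longleftrightarrow> (\<exists>\<xi> \<eta>.
     cone_tangent L v = span {v, \<i> *s v, \<xi>, \<eta>} \<and>
     vol2 v \<xi> \<eta> \<noteq> 0 \<and> \<rho> = sgn ((vol2 v \<xi> \<eta>)\<^sup>2))"

definition squared_phase2 ::
  "(cp1 \<times> cp2) set \<Rightarrow> (complex^2) \<times> (complex^3) \<Rightarrow> complex \<Rightarrow> bool" where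
  "squared_phase2 \<Lambda> v \<rho> \<longleftrightarrow> (\<exists>\<xi> \<eta> \<zeta>.
     cone_tangent2 \<Lambda> v =
       span {(fst v, 0), (\<i> *s fst v, 0), (0, snd v), (0, \<i> *s snd v), \<xi>, \<eta>, \<zeta>} \<and>
     vol12 v \<xi> \<eta> \<zeta> \<noteq> 0 \<and> \<rho> = sgn ((vol12 v \<xi> \<eta> \<zeta>)\<^sup>2))"

text \<open>The path \<open>x \<mapsto> \<rho>\<close> of unit complex numbers specified by \<open>P x \<rho>\<close> closes up at infinity to a loop
  of degree \<open>d\<close>.\<close>

definition has_loop_degree :: "(real \<Rightarrow> complex \<Rightarrow> bool) \<Rightarrow> int \<Rightarrow> bool" where
  "has_loop_degree P d \<longleftrightarrow> (\<exists>\<theta> a. continuous_on UNIV \<theta> \<and> (\<forall>x. P x (cis (\<theta> x))) \<and>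
     (\<theta> \<longlongrightarrow> a) at_bot \<and> (\<theta> \<longlongrightarrow> a + 2 * pi * of_int d) at_top)"

text \<open>The index of a quilted disk with seam \<open>Im z = 1\<close> and boundary \<open>Im z = 0\<close>, which touch at
  infinity, is the Maslov index of the boundary loop minus that of the seam loop, both traversed in
  the direction of increasing \<open>x\<close>: the seam is traversed negatively by the boundary of the strip, and
  positively by that of the half-plane, whose target has the conjugate complex structure in \<open>\<Lambda>\<close>.
  The result does not depend on the lifts. Changing \<open>v1\<close> does not change either degree since the
  half-plane together with infinity is a disk, and changing \<open>v2\<close> changes both degrees by the same
  amount.\<close>

definition has_quilted_maslov_index ::
  "(cp1 \<times> cp2) set \<Rightarrow> cp2 set \<Rightarrow> (complex \<Rightarrow> cp1) \<Rightarrow> (complex \<Rightarrow> cp2) \<Rightarrow> int \<Rightarrow> bool" where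
  "has_quilted_maslov_index \<Lambda> L u1 u2 m \<longleftrightarrow> (\<exists>v1 v2 d\<^sub>L d\<^sub>\<Lambda>.
     lifts upper_patch u1 v1 \<and> lifts lower_patch u2 v2 \<and>
     has_loop_degree (\<lambda>x. squared_phase L (v2 (of_real x))) d\<^sub>L \<and>
     has_loop_degree (\<lambda>x. squared_phase2 \<Lambda> (v1 (of_real x + \<i>), v2 (of_real x + \<i>))) d\<^sub>\<Lambda> \<and>
     m = d\<^sub>L - d\<^sub>\<Lambda>)"

end

theory Submission
  imports Defs "HOL-Real_Asymp.Real_Asymp"
begin

text \<open>Write \<open>v\<close> for the tuple of affine functions of \<open>z\<close> that are the homogeneous coordinates of \<open>u1\<close>
  or \<open>u2\<close>. Holomorphicity, the seam condition and the boundary condition are read off from \<open>v\<close>. On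
  the seam \<open>z = x + \<i>\<close> the condition is \<open>2 (x\<^sup>2 + 25) = (x\<^sup>2 + 49) + (x\<^sup>2 + 1)\<close>; at \<open>z = x\<close> the point
  lies on \<open>L_AC\<close> with \<open>(A, B, C)\<close> proportional to the real vector \<open>(\<epsilon> x, 6 \<epsilon>, x / sqrt 2)\<close>.

  For the areas, Lagrange's identity shows that a curve \<open>proj \<circ> v\<close> pulls the Fubini--Study form back
  to \<open>n + 1\<close> times \<open>(\<bar>v\<bar>\<^sup>2 \<bar>v'\<bar>\<^sup>2 - \<bar>\<langle>v, v'\<rangle>\<bar>\<^sup>2) / (\<pi> \<bar>v\<bar>\<^sup>4)\<close>, independently of the chart
  (\<open>fs_pullback_proj\<close>). Since \<open>v\<close> is affine, the curve parametrises a projective line, and for each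
  of \<open>u1\<close>, \<open>u2\<close> and the standard chart of the projective line this density is, with
  \<open>z = x + \<i> y\<close>, \<open>(n + 1) d / (\<pi> (x\<^sup>2 + (y + c)\<^sup>2 + d)\<^sup>2)\<close> for suitable real numbers \<open>c\<close> and
  \<open>d > 0\<close>. Integrating over \<open>x\<close> leaves
  \<open>(n + 1) / 2\<close> times the derivative of \<open>(y + c) / sqrt ((y + c)\<^sup>2 + d)\<close>. The values are
  \<open>(c, d) = (3, 9)\<close> for \<open>u1\<close>, giving \<open>1 - 4/5 = 1/5\<close>; \<open>(c, d) = (0, 24)\<close> for \<open>u2\<close>, giving
  \<open>3/2 \<cdot> 1/5 = 3/10\<close>; and \<open>(c, d) = (0, 1)\<close> for the whole projective line, giving \<open>2\<close>. The total area
  is \<open>1/2 = 2/4\<close>.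

  For the index, the coordinates \<open>v / (z + 6 \<i>)\<close> extend continuously to infinity on both patches.
  \<open>L_AC\<close> is the image of the real projective plane under a linear map, so at \<open>c *s w\<close>, with \<open>w\<close> the
  image of a real vector, the squared phase is that of \<open>c\<^sup>6\<close> (\<open>squared_phase_L_AC\<close>). On the
  boundary \<open>c = 1 / (x + 6 \<i>)\<close>, whose argument increases by \<open>\<pi>\<close>; so the boundary loop has degree
  \<open>3\<close>. At a point \<open>([a : b], [a : b : Z])\<close> of the correspondence the squared phase is that of \<open>Z\<^sup>2\<close>
  (\<open>squared_phase2_Lambda_S1\<close>). On the seam \<open>Z = \<epsilon> (x - 5 \<i>) / (x + 7 \<i>)\<close>, whose argument
  increases by \<open>2 \<pi>\<close>; so the seam loop has degree \<open>2\<close>, and the index is \<open>3 - 2 = 1\<close>.\<close>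

section \<open>Curves in coordinate spaces\<close>

lemma has_derivative_vec:
  fixes f :: "'a::real_normed_vector \<Rightarrow> 'b::euclidean_space^'n"
  assumes "\<And>k. ((\<lambda>x. f x $ k) has_derivative (\<lambda>h. f' h $ k)) (at x within S)"
  shows "(f has_derivative f') (at x within S)"
  unfolding has_derivative_componentwise_within[of f]
  using assms by (auto simp: Basis_vec_def inner_axis intro!: has_derivative_inner_left)

lemma has_vector_derivative_vec:
  fixes f :: "real \<Rightarrow> 'b::euclidean_space^'n"
  assumes "\<And>k. ((\<lambda>x. f x $ k) has_vector_derivative f' $ k) (at x within S)"
  shows "(f has_vector_derivative f') (at x within S)"
  unfolding has_vector_derivative_def
  by (rule has_derivative_vec) (use assms in \<open>simp add: has_vector_derivative_def\<close>)

lemma has_vector_derivative_nth: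
  "(f has_vector_derivative f') F \<Longrightarrow> ((\<lambda>x. f x $ k) has_vector_derivative f' $ k) F"
  by (rule bounded_linear.has_vector_derivative[OF bounded_linear_vec_nth])

text \<open>Equations satisfied along a curve hold for its velocity after linearisation; this is how tangent
  vectors of the cones are bounded from above.\<close>

lemma has_vector_derivative_eventually_zero:
  fixes f :: "real \<Rightarrow> 'a::real_normed_vector"
  assumes f: "(f has_vector_derivative f') (at x)" and 0: "\<forall>\<^sub>F t in nhds x. f t = 0"
  shows "f' = 0"
proof -
  have "((\<lambda>_. 0) has_vector_derivative f') (at x)"
    using f unfolding has_vector_derivative_def
    by (rule has_derivative_transform_eventually)
      (use 0 eventually_nhds_x_imp_x[OF 0] in \<open>auto intro: eventually_at_filter[THEN iffD2] elim: eventually_mono\<close>)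
  then show ?thesis
    using vector_derivative_unique_at[OF has_vector_derivative_const] by metis
qed

section \<open>The Fubini--Study form along a holomorphic curve\<close>

lemma norm_vec_square:
  fixes v :: "complex^'n"
  shows "complex_of_real ((norm v)\<^sup>2) = (\<Sum>k\<in>UNIV. v $ k * cnj (v $ k))"
  by (simp add: norm_vec_def L2_set_def sum_nonneg complex_norm_square flip: of_real_power)

definition hprod :: "complex^'n \<Rightarrow> complex^'n \<Rightarrow> complex" where
  "hprod v w = (\<Sum>k\<in>UNIV. v $ k * cnj (w $ k))"

definition gram :: "complex^'n \<Rightarrow> complex^'n \<Rightarrow> real" where
  "gram v w = (norm v)\<^sup>2 * (norm w)\<^sup>2 - (cmod (hprod v w))\<^sup>2"

lemma hprod_self: "hprod v v = complex_of_real ((norm v)\<^sup>2)"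
  by (simp only: hprod_def norm_vec_square)

lemma cnj_hprod: "cnj (hprod v w) = hprod w v"
  by (simp add: hprod_def mult.commute)

lemma hprod_simps:
  "hprod (v - w) x = hprod v x - hprod w x" "hprod x (v - w) = hprod x v - hprod x w"
  "hprod (c *s v) x = c * hprod v x" "hprod x (c *s v) = cnj c * hprod x v"
  by (simp_all add: hprod_def algebra_simps sum_subtractf sum_distrib_left)

lemma gram_complex: "complex_of_real (gram v w) = hprod v v * hprod w w - hprod v w * hprod w v"
  by (simp add: gram_def hprod_self complex_norm_square cnj_hprod del: of_real_power)

text \<open>The Gram determinant is the squared norm of the bivector \<open>v \<and> w\<close>. Hence it depends on a tangent
  vector \<open>w\<close> only modulo \<open>v\<close>, which is what makes it a quantity on projective space.\<close>

lemma gram_shear: "gram v (w - c *s v) = gram v w"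
proof -
  have "complex_of_real (gram v (w - c *s v)) = complex_of_real (gram v w)"
    unfolding gram_complex by (simp add: hprod_simps algebra_simps)
  then show ?thesis by (simp only: of_real_eq_iff)
qed

lemma gram_scale: "gram (c *s v) (c *s w) = cmod c ^ 4 * gram v w"
proof -
  have "complex_of_real (gram (c *s v) (c *s w)) = (c * cnj c)\<^sup>2 * complex_of_real (gram v w)"
    unfolding gram_complex by (simp add: hprod_simps algebra_simps power2_eq_square)
  also have "\<dots> = complex_of_real (cmod c ^ 4 * gram v w)"
    by (simp add: complex_norm_square[symmetric])
  finally show ?thesis by (simp only: of_real_eq_iff)
qed

text \<open>The Fubini--Study form on a complex tangent line. Here \<open>a\<close> and \<open>\<xi>\<close> are extended by \<open>1\<close> and \<open>0\<close> in
  the redundant coordinate \<open>i\<close>, so that \<open>1 + \<bar>z\<bar>\<^sup>2 = \<bar>a\<bar>\<^sup>2\<close> and all sums run over the whole index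
  set. The diagonal terms \<open>\<bar>z\<^sub>k\<bar>\<^sup>2\<close> missing from the second sum of the form are exactly those subtracted
  in the first one.\<close>

lemma fs_form_complex_line:
  fixes a \<xi> :: "complex^'n"
  assumes "a $ i = 1" "\<xi> $ i = 0"
  shows "fs_form i a \<xi> (\<i> *s \<xi>) = real CARD('n) / pi * gram a \<xi> / norm a ^ 4"
proof -
  define r where "r = 1 + (\<Sum>k\<in>-{i}. (cmod (a $ k))\<^sup>2)"
  have U: "sum f UNIV = f i + sum f (-{i})" for f :: "'n \<Rightarrow> 'b::comm_monoid_add"
    by (metis Compl_eq_Diff_UNIV UNIV_I finite_class.finite_UNIV sum.remove)
  have r: "r = (norm a)\<^sup>2"
    unfolding r_def norm_vec_def L2_set_def using assms(1) U[of "\<lambda>k. (cmod (a $ k))\<^sup>2"]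
    by (simp add: sum_nonneg)
  let ?w = "\<lambda>j k. \<xi> $ j * cnj ((\<i> *s \<xi>) $ k) - (\<i> *s \<xi>) $ j * cnj (\<xi> $ k)"
  have w: "?w j k = -2 * \<i> * (\<xi> $ j * cnj (\<xi> $ k))" for j k
    by simp
  have split: "(\<Sum>k\<in>-{i,j}. cnj (a $ j) * a $ k * ?w j k)
      = (\<Sum>k\<in>-{i}. cnj (a $ j) * a $ k * ?w j k) - of_real ((cmod (a $ j))\<^sup>2) * ?w j j"
    if "j \<in> -{i}" for j
  proof -
    have e: "-{i} = insert j (-{i,j})" using that by auto
    have "(\<Sum>k\<in>-{i}. cnj (a $ j) * a $ k * ?w j k)
        = cnj (a $ j) * a $ j * ?w j j + (\<Sum>k\<in>-{i,j}. cnj (a $ j) * a $ k * ?w j k)"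
      unfolding e by (subst sum.insert) auto
    then show ?thesis
      by (simp add: complex_norm_square mult.commute del: of_real_power)
  qed
  have "(\<Sum>k\<in>-{i}. of_real (r - (cmod (a $ k))\<^sup>2) * ?w k k)
      - (\<Sum>j\<in>-{i}. \<Sum>k\<in>-{i,j}. cnj (a $ j) * a $ k * ?w j k)
      = (\<Sum>k\<in>-{i}. of_real r * ?w k k)
      - (\<Sum>j\<in>-{i}. \<Sum>k\<in>-{i}. cnj (a $ j) * a $ k * ?w j k)"
    by (simp only: split cong: sum.cong) (simp add: sum_subtractf sum.distrib sum_negf algebra_simps)
  also have "\<dots> = (\<Sum>k\<in>UNIV. of_real r * ?w k k)
      - (\<Sum>j\<in>UNIV. \<Sum>k\<in>UNIV. cnj (a $ j) * a $ k * ?w j k)"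
    using assms(2) by (simp add: U)
  also have "\<dots> = -2 * \<i> * (hprod a a * hprod \<xi> \<xi> - hprod a \<xi> * hprod \<xi> a)"
    unfolding w hprod_self[of a] r[symmetric]
    by (simp add: hprod_def sum_product sum_distrib_left algebra_simps)
      (rule sum.swap)
  also have "\<dots> = -2 * \<i> * of_real (gram a \<xi>)"
    by (simp only: gram_complex)
  finally have E: "(\<Sum>k\<in>-{i}. of_real (r - (cmod (a $ k))\<^sup>2) * ?w k k)
      - (\<Sum>j\<in>-{i}. \<Sum>k\<in>-{i,j}. cnj (a $ j) * a $ k * ?w j k) = -2 * \<i> * of_real (gram a \<xi>)" .
  have "fs_form i a \<xi> (\<i> *s \<xi>)
      = Re (of_nat CARD('n) * \<i> / (2 * of_real pi * of_real r ^ 2) * (-2 * \<i> * of_real (gram a \<xi>)))"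
    unfolding fs_form_def Let_def r_def[symmetric] E by (rule refl)
  also have "\<dots> = Re (complex_of_real (real CARD('n) / pi * gram a \<xi> / r ^ 2))"
    by (simp add: field_simps)
  finally show ?thesis by (simp add: r)
qed

text \<open>In the chart \<open>i\<close> the curve is \<open>v / v\<^sub>i\<close>, and its velocity is \<open>v' / v\<^sub>i\<close> minus a multiple of
  \<open>v\<close>. The chart therefore enters the Gram determinant and the fourth power of the norm only by the
  common factor \<open>\<bar>1 / v\<^sub>i\<bar>\<^sup>4\<close>, which cancels. The last hypothesis says that \<open>S\<close> accumulates at \<open>z\<close>
  along both axes, so that the derivative within \<open>S\<close> is unique also at boundary points.\<close>

lemma fs_pullback_proj:
  fixes v :: "complex \<Rightarrow> complex^'n"
  assumes nz: "\<And>w. w \<in> S \<Longrightarrow> v w \<noteq> 0"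
    and z: "z \<in> S"
    and dv: "\<And>k. ((\<lambda>w. v w $ k) has_field_derivative v' $ k) (at z within S)"
    and S: "\<And>i e. \<lbrakk>i\<in>Basis; e>0\<rbrakk> \<Longrightarrow> \<exists>d. 0 < \<bar>d\<bar> \<and> \<bar>d\<bar> < e \<and> (z + d *\<^sub>R i) \<in> S"
  shows "fs_pullback S (\<lambda>w. proj (v w)) z
    = real CARD('n) / pi * gram (v z) v' / norm (v z) ^ 4"
proof -
  define i where "i = (SOME i. in_chart i (proj (v z)))"
  have "\<exists>i. in_chart i (proj (v z))"
    using nz[OF z] by (auto simp: in_chart_proj vec_eq_iff)
  then have "in_chart i (proj (v z))"
    unfolding i_def by (rule someI_ex)
  then have vi: "v z $ i \<noteq> 0"
    using nz[OF z] by (simp add: in_chart_proj)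
  define a where "a = (1 / v z $ i) *s v z"
  define \<xi> where "\<xi> = (1 / v z $ i) *s v' - (v' $ i / v z $ i) *s a"
  have d: "((\<lambda>w. chart i (proj (v w))) has_derivative (\<lambda>h. h *s \<xi>)) (at z within S)"
  proof (rule has_derivative_transform[OF z])
    show "chart i (proj (v w)) = (1 / v w $ i) *s v w" if "w \<in> S" for w
      using nz[OF that] by (rule chart_proj)
    show "((\<lambda>w. (1 / v w $ i) *s v w) has_derivative (\<lambda>h. h *s \<xi>)) (at z within S)"
    proof (rule has_derivative_vec)
      fix k
      have "((\<lambda>w. v w $ k / v w $ i) has_field_derivative \<xi> $ k) (at z within S)"
        by (rule DERIV_cong[OF DERIV_divide[OF dv dv vi]]) (use vi in \<open>simp add: \<xi>_def a_def field_simps\<close>)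
      then show "((\<lambda>w. ((1 / v w $ i) *s v w) $ k) has_derivative (\<lambda>h. (h *s \<xi>) $ k)) (at z within S)"
        by (simp add: has_field_derivative_def mult_commute_abs)
    qed
  qed
  have D: "frechet_derivative (\<lambda>w. chart i (proj (v w))) (at z within S) = (\<lambda>h. h *s \<xi>)"
    using frechet_derivative_works d S
    by (metis (no_types, lifting) differentiableI frechet_derivative_unique_within)
  have "fs_pullback S (\<lambda>w. proj (v w)) z = fs_form i a \<xi> (\<i> *s \<xi>)"
    unfolding fs_pullback_def Let_def i_def[symmetric] D chart_proj[OF nz[OF z]] a_def by simp
  also have "\<dots> = real CARD('n) / pi * gram a \<xi> / norm a ^ 4"
    by (rule fs_form_complex_line) (use vi in \<open>simp_all add: \<xi>_def a_def\<close>)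
  also have "gram a \<xi> = cmod (1 / v z $ i) ^ 4 * gram (v z) v'"
    unfolding \<xi>_def gram_shear unfolding a_def gram_scale ..
  also have "norm a ^ 4 = cmod (1 / v z $ i) ^ 4 * norm (v z) ^ 4"
  proof -
    have "complex_of_real ((norm a)\<^sup>2) = complex_of_real ((cmod (1 / v z $ i))\<^sup>2 * (norm (v z))\<^sup>2)"
      unfolding of_real_mult hprod_self[symmetric] a_def hprod_simps complex_norm_square by simp
    then have "(norm a)\<^sup>2 = (cmod (1 / v z $ i))\<^sup>2 * (norm (v z))\<^sup>2"
      by (simp only: of_real_eq_iff)
    then have "((norm a)\<^sup>2)\<^sup>2 = ((cmod (1 / v z $ i))\<^sup>2 * (norm (v z))\<^sup>2)\<^sup>2"
      by simp
    then show ?thesis by (simp add: power_mult_distrib)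
  qed
  finally show ?thesis
    using vi by simp
qed
lemma cproj_holomorphic_on_proj:
  assumes nz: "\<And>z. z \<in> S \<Longrightarrow> v z \<noteq> 0" and hol: "\<And>k. (\<lambda>z. v z $ k) holomorphic_on S"
  shows "cproj_holomorphic_on (\<lambda>z. proj (v z)) S"
  unfolding cproj_holomorphic_on_def
proof (intro allI conjI)
  fix i k
  have eq: "{z \<in> S. in_chart i (proj (v z))} = {z \<in> S. v z $ i \<noteq> 0}"
    using nz by (auto simp: in_chart_proj)
  have "openin (top_of_set S) (S \<inter> (\<lambda>z. v z $ i) -` (- {0}))"
    by (intro continuous_openin_preimage_gen holomorphic_on_imp_continuous_on hol) auto
  then show "openin (top_of_set S) {z \<in> S. in_chart i (proj (v z))}"
    unfolding eq by (simp add: vimage_def Int_def)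
  have "(\<lambda>z. v z $ k / v z $ i) holomorphic_on {z \<in> S. v z $ i \<noteq> 0}"
    by (intro holomorphic_on_divide holomorphic_on_subset[OF hol]) auto
  then show "(\<lambda>z. chart i (proj (v z)) $ k) holomorphic_on {z \<in> S. in_chart i (proj (v z))}"
    unfolding eq by (rule holomorphic_transform) (use nz in \<open>simp add: chart_proj\<close>)
qed

section \<open>The mass of the Fubini--Study density over strips\<close>

lemma measurable_Complex:
  "(\<lambda>p. Complex (fst p) (snd p)) \<in> (lborel \<Otimes>\<^sub>M lborel) \<rightarrow>\<^sub>M borel"
  unfolding lborel_prod Complex_eq
  by (simp, intro borel_measurable_continuous_onI continuous_intros)

text \<open>The identification of the plane with the product of two lines, which makes Tonelli's theorem
  available for integrals over the complex numbers.\<close>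

lemma lborel_complex: "lborel = distr (lborel \<Otimes>\<^sub>M lborel) borel (\<lambda>p. Complex (fst p) (snd p))"
proof (rule lborel_eqI)
  have m: "(\<lambda>p. Complex (fst p) (snd p)) \<in> (lborel \<Otimes>\<^sub>M lborel) \<rightarrow>\<^sub>M borel"
    by (rule measurable_Complex)
  fix l u :: complex
  assume "\<And>b. b \<in> Basis \<Longrightarrow> l \<bullet> b \<le> u \<bullet> b"
  from this[of 1] this[of \<i>] have le: "Re l \<le> Re u" "Im l \<le> Im u"
    by (simp_all add: Basis_complex_def inner_complex_def)
  have "(\<lambda>p. Complex (fst p) (snd p)) -` box l u = {Re l<..<Re u} \<times> {Im l<..<Im u}"
    by (auto simp: box_def Basis_complex_def inner_complex_def)
  with m have "emeasure (distr (lborel \<Otimes>\<^sub>M lborel) borel (\<lambda>p. Complex (fst p) (snd p))) (box l u)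
      = emeasure (lborel \<Otimes>\<^sub>M lborel) ({Re l<..<Re u} \<times> {Im l<..<Im u})"
    by (subst emeasure_distr) auto
  also have "\<dots> = ennreal ((Re u - Re l) * (Im u - Im l))"
    using le by (subst lborel.emeasure_pair_measure_Times) (auto simp: ennreal_mult)
  also have "(Re u - Re l) * (Im u - Im l) = (\<Prod>b\<in>Basis. (u - l) \<bullet> b)"
    by (simp add: Basis_complex_def inner_complex_def)
  finally show "emeasure (distr (lborel \<Otimes>\<^sub>M lborel) borel (\<lambda>p. Complex (fst p) (snd p))) (box l u)
      = ennreal (\<Prod>b\<in>Basis. (u - l) \<bullet> b)" .
qed simp

lemma nn_integral_complex:
  assumes [measurable]: "f \<in> borel_measurable borel"
  shows "(\<integral>\<^sup>+z. f z \<partial>lborel) = (\<integral>\<^sup>+y. (\<integral>\<^sup>+x. f (Complex x y) \<partial>lborel) \<partial>lborel)"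
proof -
  have m [measurable]: "(\<lambda>p. Complex (fst p) (snd p)) \<in> (lborel \<Otimes>\<^sub>M lborel) \<rightarrow>\<^sub>M borel"
    by (rule measurable_Complex)
  have m2: "(\<lambda>(x, y). f (Complex x y)) \<in> borel_measurable (lborel \<Otimes>\<^sub>M lborel)"
    using measurable_compose[OF m assms] by (simp add: case_prod_beta)
  have "(\<integral>\<^sup>+z. f z \<partial>lborel) = (\<integral>\<^sup>+p. f (Complex (fst p) (snd p)) \<partial>(lborel \<Otimes>\<^sub>M lborel))"
    by (subst lborel_complex) (simp add: nn_integral_distr)
  also have "\<dots> = (\<integral>\<^sup>+y. (\<integral>\<^sup>+x. f (Complex x y) \<partial>lborel) \<partial>lborel)"
    using lborel_pair.nn_integral_snd[OF m2] by (simp add: case_prod_unfold)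
  finally show ?thesis .
qed

lemma tendsto_real_of_ereal_at_top:
  "(f \<longlongrightarrow> l) at_top \<Longrightarrow> ((f \<circ> real_of_ereal) \<longlongrightarrow> l) (at_left \<infinity>)"
  by (simp add: ereal_tendsto_simps)

lemma tendsto_real_of_ereal_at_bot:
  "(f \<longlongrightarrow> l) at_bot \<Longrightarrow> ((f \<circ> real_of_ereal) \<longlongrightarrow> l) (at_right (-\<infinity>))"
  by (simp add: ereal_tendsto_simps)

lemma nn_integral_FTC_UNIV:
  fixes f F :: "real \<Rightarrow> real"
  assumes F: "\<And>x. (F has_real_derivative f x) (at x)" and f: "\<And>x. isCont f x"
    and nonneg: "\<And>x. 0 \<le> f x" and lim: "(F \<longlongrightarrow> A) at_bot" "(F \<longlongrightarrow> B) at_top"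
  shows "(\<integral>\<^sup>+x. ennreal (f x) \<partial>lborel) = ennreal (B - A)"
proof -
  have *: "set_integrable lborel (einterval (-\<infinity>) \<infinity>) f" "(LBINT x=-\<infinity>..\<infinity>. f x) = B - A"
    by (rule interval_integral_FTC_nonneg[OF _ F f _ tendsto_real_of_ereal_at_bot[OF lim(1)]
          tendsto_real_of_ereal_at_top[OF lim(2)]]; simp add: nonneg)+
  then have "integrable lborel f" "(LINT x|lborel. f x) = B - A"
    by (simp_all add: set_integrable_def interval_lebesgue_integral_def set_lebesgue_integral_def)
  then show ?thesis
    using nn_integral_eq_integral[of lborel f] nonneg by simp
qed

text \<open>The Fubini--Study density, divided by \<open>n + 1\<close>, of a projective line in an affine parametrisation
  with \<open>\<bar>v z\<bar>\<^sup>2\<close> proportional to \<open>\<bar>z + \<i> c\<bar>\<^sup>2 + d\<close>.\<close>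

definition line_density :: "real \<Rightarrow> real \<Rightarrow> complex \<Rightarrow> real" where
  "line_density c d z = d / (pi * ((Re z)\<^sup>2 + (Im z + c)\<^sup>2 + d)\<^sup>2)"

text \<open>With \<open>s\<^sup>2 = (y + c)\<^sup>2 + d\<close>, a primitive of \<open>1 / (x\<^sup>2 + s\<^sup>2)\<^sup>2\<close> is
  \<open>(x / (x\<^sup>2 + s\<^sup>2) + arctan (x / s) / s) / (2 s\<^sup>2)\<close>.\<close>

lemma nn_integral_line_density_horizontal:
  fixes y :: real
  assumes "d > 0"
  shows "(\<integral>\<^sup>+x. ennreal (line_density c d (Complex x y)) \<partial>lborel) = ennreal (d / (2 * sqrt ((y + c)\<^sup>2 + d) ^ 3))"
proof -
  define s where "s = sqrt ((y + c)\<^sup>2 + d)"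
  have s: "s > 0" "(y + c)\<^sup>2 + d = s\<^sup>2"
    using assms by (auto simp: s_def add_nonneg_pos)
  define F where "F = (\<lambda>x. d / (2 * pi * s\<^sup>2) * (x / (x\<^sup>2 + s\<^sup>2) + arctan (x / s) / s))"
  have b: "line_density c d (Complex x y) = d / (pi * (x\<^sup>2 + s\<^sup>2)\<^sup>2)" for x
    by (simp add: line_density_def s(2)[symmetric] add.assoc)
  have p: "x\<^sup>2 + s\<^sup>2 > 0" for x
    using s by (simp add: add_nonneg_pos)
  have F: "(F has_real_derivative d / (pi * (x\<^sup>2 + s\<^sup>2)\<^sup>2)) (at x)" for x
  proof -
    have e: "inverse (1 + (x / s)\<^sup>2) = s\<^sup>2 / (x\<^sup>2 + s\<^sup>2)"
      using s(1) p[of x] by (simp add: divide_simps)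
    have "((\<lambda>x. x / (x\<^sup>2 + s\<^sup>2) + arctan (x / s) / s) has_real_derivative
        ((x\<^sup>2 + s\<^sup>2) - x * (2 * x)) / (x\<^sup>2 + s\<^sup>2)\<^sup>2 + (inverse (1 + (x / s)\<^sup>2) * (1 / s)) / s) (at x)"
      using s(1) p[of x]
      by (auto intro!: derivative_eq_intros simp: power2_eq_square)
    also have "((x\<^sup>2 + s\<^sup>2) - x * (2 * x)) / (x\<^sup>2 + s\<^sup>2)\<^sup>2 + (inverse (1 + (x / s)\<^sup>2) * (1 / s)) / s
        = 2 * s\<^sup>2 / (x\<^sup>2 + s\<^sup>2)\<^sup>2"
      unfolding e using s(1) p[of x] by (simp add: divide_simps) algebra
    finally show ?thesis
      unfolding F_def by (rule DERIV_cong[OF DERIV_cmult]) (use s(1) in \<open>simp add: field_simps\<close>)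
  qed
  have l: "(F \<longlongrightarrow> d / (2 * pi * s\<^sup>2) * (0 + (- pi / 2) / s)) at_bot"
    "(F \<longlongrightarrow> d / (2 * pi * s\<^sup>2) * (0 + (pi / 2) / s)) at_top"
  proof -
    have "((\<lambda>x. x / (x\<^sup>2 + s\<^sup>2)) \<longlongrightarrow> 0) at_bot" "((\<lambda>x. arctan (x / s)) \<longlongrightarrow> - pi / 2) at_bot"
      using s(1) by (real_asymp simp: field_simps)+
    then show "(F \<longlongrightarrow> d / (2 * pi * s\<^sup>2) * (0 + (- pi / 2) / s)) at_bot"
      unfolding F_def by (rule tendsto_mult[OF tendsto_const tendsto_add[OF _ tendsto_divide[OF _ tendsto_const]]])
        (use s(1) in simp)
    have "((\<lambda>x. x / (x\<^sup>2 + s\<^sup>2)) \<longlongrightarrow> 0) at_top" "((\<lambda>x. arctan (x / s)) \<longlongrightarrow> pi / 2) at_top"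
      using s(1) by (real_asymp simp: field_simps)+
    then show "(F \<longlongrightarrow> d / (2 * pi * s\<^sup>2) * (0 + (pi / 2) / s)) at_top"
      unfolding F_def by (rule tendsto_mult[OF tendsto_const tendsto_add[OF _ tendsto_divide[OF _ tendsto_const]]])
        (use s(1) in simp)
  qed
  have "(\<integral>\<^sup>+x. ennreal (d / (pi * (x\<^sup>2 + s\<^sup>2)\<^sup>2)) \<partial>lborel)
      = ennreal (d / (2 * pi * s\<^sup>2) * (0 + (pi / 2) / s) - d / (2 * pi * s\<^sup>2) * (0 + (- pi / 2) / s))"
    by (rule nn_integral_FTC_UNIV[OF F _ _ l])
      (use assms p in \<open>auto intro!: continuous_intros simp: less_imp_neq[symmetric]\<close>)
  also have "d / (2 * pi * s\<^sup>2) * (0 + (pi / 2) / s) - d / (2 * pi * s\<^sup>2) * (0 + (- pi / 2) / s)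
      = d / (2 * s ^ 3)"
    using s(1) by (simp add: field_simps power3_eq_cube power2_eq_square)
  finally show ?thesis unfolding b s_def .
qed

text \<open>A primitive of the density integrated over horizontal lines. Its limits at infinity are
  \<open>\<plusminus> 1 / 2\<close>, so that the whole plane has mass \<open>1\<close>.\<close>

definition line_primitive :: "real \<Rightarrow> real \<Rightarrow> real \<Rightarrow> real" where
  "line_primitive c d y = (y + c) / (2 * sqrt ((y + c)\<^sup>2 + d))"

lemma line_primitive_deriv:
  assumes "d > 0"
  shows "(line_primitive c d has_real_derivative d / (2 * sqrt ((y + c)\<^sup>2 + d) ^ 3)) (at y)"
proof -
  have p: "(y + c)\<^sup>2 + d > 0" using assms by (simp add: add_nonneg_pos)
  define s where "s = sqrt ((y + c)\<^sup>2 + d)"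
  have s: "s > 0" "s\<^sup>2 = (y + c)\<^sup>2 + d"
    using p by (auto simp: s_def)
  have "(line_primitive c d has_real_derivative
      (2 * s - (y + c) * (2 * (inverse s / 2 * (2 * (y + c))))) / (2 * s)\<^sup>2) (at y)"
    unfolding line_primitive_def s_def
    using p by (auto intro!: derivative_eq_intros simp: power2_eq_square)
  also have "(2 * s - (y + c) * (2 * (inverse s / 2 * (2 * (y + c))))) / (2 * s)\<^sup>2
     = (s\<^sup>2 - (y + c)\<^sup>2) / (2 * s ^ 3)"
    using s(1) by (simp add: field_simps power2_eq_square power3_eq_cube)
  finally show ?thesis using s by (simp add: s_def)
qed

lemma has_integral_line_density:
  assumes d: "d > 0" and [measurable]: "T \<in> sets borel"
    and T: "(\<integral>\<^sup>+y. ennreal (d / (2 * sqrt ((y + c)\<^sup>2 + d) ^ 3)) * indicator T y \<partial>lborel) = ennreal A"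
    and A: "A \<ge> 0"
  shows "(line_density c d has_integral A) {z. Im z \<in> T}"
proof -
  let ?f = "\<lambda>z. line_density c d z * indicator T (Im z)"
  have bm [measurable]: "line_density c d \<in> borel_measurable borel"
    unfolding line_density_def by measurable
  have b0: "line_density c d z \<ge> 0" for z
    using d by (simp add: line_density_def)
  have "(\<integral>\<^sup>+z. ennreal (?f z) \<partial>lborel)
      = (\<integral>\<^sup>+y. (\<integral>\<^sup>+x. ennreal (line_density c d (Complex x y)) \<partial>lborel) * indicator T y \<partial>lborel)"
    by (subst nn_integral_complex)
      (auto simp: ennreal_mult' ennreal_indicator nn_integral_multc b0 intro!: nn_integral_cong split: split_indicator)
  also have "\<dots> = ennreal A"
    unfolding nn_integral_line_density_horizontal[OF d] by (rule T)
  finally have "(?f has_integral A) UNIV"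
    using A by (intro nn_integral_has_integral) (auto simp: b0)
  moreover have "?f = (\<lambda>z. if z \<in> {z. Im z \<in> T} then line_density c d z else 0)"
    by (auto split: split_indicator)
  ultimately show ?thesis
    by (simp only: has_integral_restrict_UNIV)
qed

lemma has_integral_line_density_upper:
  assumes "d > 0"
  shows "(line_density c d has_integral (1 / 2 - line_primitive c d a)) {z. Im z \<ge> a}"
proof -
  have l: "(line_primitive c d \<longlongrightarrow> 1 / 2) at_top"
    unfolding line_primitive_def using assms by real_asymp
  have p: "0 \<le> d / (2 * sqrt ((y + c)\<^sup>2 + d) ^ 3)" for y
    using assms by simp
  have "line_primitive c d a \<le> line_primitive c d y" if "a \<le> y" for y
    using DERIV_nonneg_imp_nondecreasing[OF that, of "line_primitive c d"] line_primitive_deriv[OF assms] p by blast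
  then have "line_primitive c d a \<le> 1 / 2"
    by (intro tendsto_lowerbound[OF l]) (auto simp: eventually_at_top_linorder)
  then have "(line_density c d has_integral (1 / 2 - line_primitive c d a)) {z. Im z \<in> {a..}}"
    using assms p l by (intro has_integral_line_density nn_integral_FTC_atLeast line_primitive_deriv) auto
  then show ?thesis by simp
qed

lemma has_integral_line_density_strip:
  assumes "d > 0" "a \<le> b"
  shows "(line_density c d has_integral (line_primitive c d b - line_primitive c d a)) {z. a \<le> Im z \<and> Im z \<le> b}"
proof -
  have p: "0 \<le> d / (2 * sqrt ((y + c)\<^sup>2 + d) ^ 3)" for y
    using assms by simp
  have "line_primitive c d a \<le> line_primitive c d b"
    using DERIV_nonneg_imp_nondecreasing[OF assms(2), of "line_primitive c d"] line_primitive_deriv[OF assms(1)] p by blast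
  then have "(line_density c d has_integral (line_primitive c d b - line_primitive c d a)) {z. Im z \<in> {a..b}}"
    using assms p by (intro has_integral_line_density nn_integral_FTC_Icc line_primitive_deriv) auto
  then show ?thesis by simp
qed

lemma has_integral_line_density_UNIV:
  assumes "d > 0"
  shows "(line_density c d has_integral 1) UNIV"
proof -
  have l: "(line_primitive c d \<longlongrightarrow> 1 / 2) at_top" "(line_primitive c d \<longlongrightarrow> - (1 / 2)) at_bot"
    unfolding line_primitive_def using assms by real_asymp+
  have p: "(y + c)\<^sup>2 + d > 0" for y using assms by (simp add: add_nonneg_pos)
  have "(\<integral>\<^sup>+y. ennreal (d / (2 * sqrt ((y + c)\<^sup>2 + d) ^ 3)) \<partial>lborel) = ennreal (1 / 2 - - (1 / 2))"
    by (rule nn_integral_FTC_UNIV[OF line_primitive_deriv[OF assms] _ _ l(2,1)])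
      (use assms p in \<open>auto intro!: continuous_intros simp: less_imp_neq[symmetric]\<close>)
  then have "(line_density c d has_integral 1) {z. Im z \<in> UNIV}"
    using assms by (intro has_integral_line_density) auto
  then show ?thesis by simp
qed

section \<open>Areas of the patches\<close>

text \<open>The hypothesis on \<open>S\<close> makes derivatives within \<open>S\<close> unique, and for affine \<open>v\<close> the density
  hypothesis comes from completing the square in \<open>\<bar>v\<bar>\<^sup>2\<close>.\<close>

lemma symplectic_area_proj:
  fixes v :: "complex \<Rightarrow> complex^'n"
  assumes nz: "\<And>z. z \<in> S \<Longrightarrow> v z \<noteq> 0"
    and dv: "\<And>z k. z \<in> S \<Longrightarrow> ((\<lambda>w. v w $ k) has_field_derivative v' z $ k) (at z within S)"
    and S: "\<And>z i e. \<lbrakk>z \<in> S; i \<in> Basis; e > 0\<rbrakk> \<Longrightarrow> \<exists>d. 0 < \<bar>d\<bar> \<and> \<bar>d\<bar> < e \<and> z + d *\<^sub>R i \<in> S"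
    and dens: "\<And>z. z \<in> S \<Longrightarrow> gram (v z) (v' z) / (pi * norm (v z) ^ 4) = line_density c d z"
    and int: "(line_density c d has_integral A) S" and d: "d > 0"
  shows "fs_pullback S (\<lambda>z. proj (v z)) absolutely_integrable_on S"
    and "symplectic_area S (\<lambda>z. proj (v z)) = real CARD('n) * A"
proof -
  have eq: "fs_pullback S (\<lambda>z. proj (v z)) z = real CARD('n) * line_density c d z" if "z \<in> S" for z
    using fs_pullback_proj[OF nz that dv[OF that] S[OF that]] dens[OF that, symmetric] by simp
  have *: "(fs_pullback S (\<lambda>z. proj (v z)) has_integral (real CARD('n) * A)) S"
    by (rule has_integral_eq[OF _ has_integral_mult_right[OF int]]) (simp add: eq)
  have "0 \<le> fs_pullback S (\<lambda>z. proj (v z)) z" if "z \<in> S" for z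
    using d by (simp add: eq[OF that] line_density_def)
  with * show "fs_pullback S (\<lambda>z. proj (v z)) absolutely_integrable_on S"
    by (intro nonnegative_absolutely_integrable_1) auto
  from * show "symplectic_area S (\<lambda>z. proj (v z)) = real CARD('n) * A"
    unfolding symplectic_area_def by (rule integral_unique)
qed

lemma strip_approachable:
  assumes "z \<in> {z. a \<le> Im z \<and> Im z \<le> b}" "a < b" "i \<in> Basis" "0 < e"
  shows "\<exists>d. 0 < \<bar>d\<bar> \<and> \<bar>d\<bar> < e \<and> z + d *\<^sub>R i \<in> {z. a \<le> Im z \<and> Im z \<le> b}"
proof (cases "i = \<i> \<and> Im z = b")
  case True
  then show ?thesis
    \<comment> \<open>On the upper edge one has to step downwards.\<close>
    using assms by (intro exI[of _ "- min (e / 2) (b - a)"]) (auto simp: min_def abs_if)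
next
  case False
  then show ?thesis
    using assms by (intro exI[of _ "if i = \<i> then min (e / 2) (b - Im z) else e / 2"])
      (auto simp: Basis_complex_def min_def abs_if)
qed

lemma upper_approachable:
  assumes "z \<in> {z. a \<le> Im z}" "i \<in> Basis" "0 < e"
  shows "\<exists>d. 0 < \<bar>d\<bar> \<and> \<bar>d\<bar> < e \<and> z + d *\<^sub>R i \<in> {z. a \<le> Im z}"
  using assms by (intro exI[of _ "e / 2"]) (auto simp: Basis_complex_def)

lemma norm_square_2: "(norm (v :: complex^2))\<^sup>2 = (cmod (v $ 1))\<^sup>2 + (cmod (v $ 2))\<^sup>2"
  by (simp add: norm_vec_def L2_set_def sum_2)

lemma norm_square_3:
  "(norm (v :: complex^3))\<^sup>2 = (cmod (v $ 1))\<^sup>2 + (cmod (v $ 2))\<^sup>2 + (cmod (v $ 3))\<^sup>2"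
  by (simp add: norm_vec_def L2_set_def sum_3)

text \<open>For affine \<open>v\<close> with derivative \<open>w\<close>, completing the square gives
  \<open>\<bar>v z\<bar>\<^sup>2 = \<kappa> (\<bar>z + \<i> c\<bar>\<^sup>2 + d)\<close> with \<open>\<kappa> = \<bar>w\<bar>\<^sup>2\<close>, provided that the minimum is attained on the
  imaginary axis. The bivector \<open>v \<and> w\<close> is constant. At the minimum \<open>v\<close> is orthogonal to \<open>w\<close> and
  \<open>\<bar>v\<bar>\<^sup>2 = \<kappa> d\<close>, whence the value \<open>\<kappa>\<^sup>2 d\<close> of the Gram determinant.\<close>

lemma line_density_eqI:
  assumes n: "(norm v)\<^sup>2 = \<kappa> * ((Re z)\<^sup>2 + (Im z + c)\<^sup>2 + d)" and g: "gram v w = \<kappa>\<^sup>2 * d" and "\<kappa> \<noteq> 0"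
  shows "gram v w / (pi * norm v ^ 4) = line_density c d z"
proof -
  have "norm v ^ 4 = \<kappa>\<^sup>2 * ((Re z)\<^sup>2 + (Im z + c)\<^sup>2 + d)\<^sup>2"
    using arg_cong[OF n, of "\<lambda>x. x\<^sup>2"] by (simp add: power_mult_distrib)
  then show ?thesis
    using \<open>\<kappa> \<noteq> 0\<close> by (simp add: line_density_def g)
qed

lemma cp1_area_eq: "cp1_area = 2"
proof -
  have "symplectic_area UNIV (\<lambda>z. proj (vector [1, z] :: complex^2)) = real CARD(2) * 1"
  proof (rule symplectic_area_proj(2)[where v' = "\<lambda>_. vector [0, 1]" and c = 0 and d = 1])
    fix z :: complex
    show "(vector [1, z] :: complex^2) \<noteq> 0" by (simp add: vec_eq_iff forall_2)
    show "((\<lambda>w. (vector [1, w] :: complex^2) $ k) has_field_derivative (vector [0, 1] :: complex^2) $ k) (at z within UNIV)" for k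
      using exhaust_2[of k] by (elim disjE) simp_all
    show "\<exists>d. 0 < \<bar>d\<bar> \<and> \<bar>d\<bar> < e \<and> z + d *\<^sub>R i \<in> UNIV" if "0 < e" for i and e :: real
      using that by (intro exI[of _ "e / 2"]) auto
    have n: "(norm (vector [1, z] :: complex^2))\<^sup>2 = 1 * ((Re z)\<^sup>2 + (Im z + 0)\<^sup>2 + 1)"
      by (simp add: norm_square_2 cmod_power2)
    have "gram (vector [1, z] :: complex^2) (vector [0, 1]) = 1\<^sup>2 * 1"
      by (simp add: gram_def norm_square_2 hprod_def sum_2)
    with n show "gram (vector [1, z] :: complex^2) (vector [0, 1]) / (pi * norm (vector [1, z] :: complex^2) ^ 4) = line_density 0 1 z"
      by (rule line_density_eqI) simp
  qed (simp_all add: has_integral_line_density_UNIV)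
  then show ?thesis by (simp add: cp1_area_def)
qed

lemma area_u1:
  fixes e :: real
  assumes e: "e\<^sup>2 = 1"
  defines "v \<equiv> \<lambda>z. vector [of_real e * (z + 6 * \<i>), \<i> * z] :: complex^2"
  shows "fs_pullback upper_patch (\<lambda>z. proj (v z)) absolutely_integrable_on upper_patch"
    and "symplectic_area upper_patch (\<lambda>z. proj (v z)) = 1 / 5"
proof -
  have nz: "v z \<noteq> 0" if "z \<in> upper_patch" for z
    using that e by (auto simp: v_def vec_eq_iff forall_2 upper_patch_def)
  have dv: "((\<lambda>w. v w $ k) has_field_derivative (vector [of_real e, \<i>] :: complex^2) $ k) (at z within upper_patch)" for z k
    using exhaust_2[of k] by (elim disjE) (auto simp: v_def intro!: derivative_eq_intros)
  have ap: "\<exists>d. 0 < \<bar>d\<bar> \<and> \<bar>d\<bar> < e \<and> z + d *\<^sub>R i \<in> upper_patch" if "z \<in> upper_patch" "i \<in> Basis" "0 < e" for z i e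
    using upper_approachable[of z 1 i e] that by (simp add: upper_patch_def)
  have dens: "gram (v z) (vector [of_real e, \<i>]) / (pi * norm (v z) ^ 4) = line_density 3 9 z" for z
  proof (rule line_density_eqI)
    show n: "(norm (v z))\<^sup>2 = 2 * ((Re z)\<^sup>2 + (Im z + 3)\<^sup>2 + 9)"
      using e by (simp add: v_def norm_square_2 norm_mult power_mult_distrib cmod_power2) (simp add: algebra_simps power2_eq_square)
    have "(norm (vector [of_real e, \<i>] :: complex^2))\<^sup>2 = 2"
      using e by (simp add: norm_square_2)
    moreover have "hprod (v z) (vector [of_real e, \<i>]) = of_real (e\<^sup>2) * (z + 6 * \<i>) + z"
      by (simp add: hprod_def sum_2 v_def power2_eq_square complex_eq_iff algebra_simps)
    ultimately show "gram (v z) (vector [of_real e, \<i>]) = 2\<^sup>2 * 9"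
      unfolding gram_def n e by (simp add: cmod_power2) (simp add: algebra_simps power2_eq_square)
  qed simp
  have h: "line_primitive 3 9 1 = 2 / 5"
    using real_sqrt_unique[of 5 25] by (simp add: line_primitive_def)
  have int: "(line_density 3 9 has_integral 1 / 2 - line_primitive 3 9 1) upper_patch"
    unfolding upper_patch_def by (rule has_integral_line_density_upper) simp
  show "fs_pullback upper_patch (\<lambda>z. proj (v z)) absolutely_integrable_on upper_patch"
    by (rule symplectic_area_proj(1)[OF nz dv ap dens int]) simp_all
  show "symplectic_area upper_patch (\<lambda>z. proj (v z)) = 1 / 5"
    by (subst symplectic_area_proj(2)[OF nz dv ap dens int]) (simp_all add: h)
qed

lemma area_u2:
  fixes e :: real
  assumes e: "e\<^sup>2 = 1"
  defines "v \<equiv> \<lambda>z. vector [of_real e * (z + 6 * \<i>), \<i> * z, of_real e * (z - 6 * \<i>)] :: complex^3"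
  shows "fs_pullback lower_patch (\<lambda>z. proj (v z)) absolutely_integrable_on lower_patch"
    and "symplectic_area lower_patch (\<lambda>z. proj (v z)) = 3 / 10"
proof -
  let ?w = "vector [of_real e, \<i>, of_real e] :: complex^3"
  have nz: "v z \<noteq> 0" if "z \<in> lower_patch" for z
    using that e by (auto simp: v_def vec_eq_iff forall_3 lower_patch_def)
  have dv: "((\<lambda>w. v w $ k) has_field_derivative ?w $ k) (at z within lower_patch)" for z k
    using exhaust_3[of k] by (elim disjE) (auto simp: v_def intro!: derivative_eq_intros)
  have ap: "\<exists>d. 0 < \<bar>d\<bar> \<and> \<bar>d\<bar> < e \<and> z + d *\<^sub>R i \<in> lower_patch" if "z \<in> lower_patch" "i \<in> Basis" "0 < e" for z i e
    using strip_approachable[of z 0 1 i e] that by (simp add: lower_patch_def)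
  have dens: "gram (v z) ?w / (pi * norm (v z) ^ 4) = line_density 0 24 z" for z
  proof (rule line_density_eqI)
    show n: "(norm (v z))\<^sup>2 = 3 * ((Re z)\<^sup>2 + (Im z + 0)\<^sup>2 + 24)"
      using e by (simp add: v_def norm_square_3 norm_mult power_mult_distrib cmod_power2) (simp add: algebra_simps power2_eq_square)
    have "(norm ?w)\<^sup>2 = 3"
      using e by (simp add: norm_square_3)
    moreover have "hprod (v z) ?w = of_real (e\<^sup>2) * (2 * z) + z"
      by (simp add: hprod_def sum_3 v_def power2_eq_square algebra_simps)
    ultimately show "gram (v z) ?w = 3\<^sup>2 * 24"
      unfolding gram_def n e by (simp add: cmod_power2)
  qed simp
  have h: "line_primitive 0 24 1 = 1 / 10" "line_primitive 0 24 0 = 0"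
    using real_sqrt_unique[of 5 25] by (simp_all add: line_primitive_def)
  have int: "(line_density 0 24 has_integral line_primitive 0 24 1 - line_primitive 0 24 0) lower_patch"
    unfolding lower_patch_def by (rule has_integral_line_density_strip) simp_all
  show "fs_pullback lower_patch (\<lambda>z. proj (v z)) absolutely_integrable_on lower_patch"
    by (rule symplectic_area_proj(1)[OF nz dv ap dens int]) simp_all
  show "symplectic_area lower_patch (\<lambda>z. proj (v z)) = 3 / 10"
    by (subst symplectic_area_proj(2)[OF nz dv ap dens int]) (simp_all add: h)
qed

section \<open>The Lagrangian and its squared phase\<close>

lemma proj_scale: "c \<noteq> 0 \<Longrightarrow> v \<noteq> 0 \<Longrightarrow> proj (c *s v) = proj v"
  using proj_eq_iff[of v "c *s v"] by (metis vector_mul_eq_0)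

text \<open>The linear map that carries the real projective plane onto \<open>L_AC\<close>. The arguments are complex in
  order to have coordinates on all of \<open>complex^3\<close>.\<close>

definition ac :: "complex \<Rightarrow> complex \<Rightarrow> complex \<Rightarrow> complex^3" where
  "ac A B C = vector [A + \<i> * B, \<i> * of_real (sqrt 2) * C, A - \<i> * B]"

lemma sqrt2_square: "(complex_of_real (sqrt 2))\<^sup>2 = 2"
  by (simp flip: of_real_power)

lemma ac_nonzero:
  assumes "(A, B, C) \<noteq> (0, 0, 0)"
  shows "ac A B C \<noteq> 0"
proof
  assume "ac A B C = 0"
  then have *: "A + \<i> * B = 0" "C = 0" "A - \<i> * B = 0"
    by (auto simp: vec_eq_iff forall_3 ac_def)
  have "2 * A = (A + \<i> * B) + (A - \<i> * B)" "2 * \<i> * B = (A + \<i> * B) - (A - \<i> * B)"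
    by (simp_all add: algebra_simps)
  with * assms show False by simp
qed

lemma proj_ac_in_L_AC:
  fixes A B C :: real
  assumes "c \<noteq> 0" "(A, B, C) \<noteq> (0, 0, 0)"
  shows "c *s ac A B C \<noteq> 0 \<and> proj (c *s ac A B C) \<in> L_AC"
proof
  have nz: "ac A B C \<noteq> 0"
    using assms(2) by (intro ac_nonzero) auto
  then show nz': "c *s ac A B C \<noteq> 0"
    using assms(1) by (auto simp: vec_eq_iff)
  define s where "s = sqrt (A\<^sup>2 + B\<^sup>2 + C\<^sup>2)"
  have pos: "A\<^sup>2 + B\<^sup>2 + C\<^sup>2 > 0"
    using assms(2) by (auto simp: add_nonneg_pos add_pos_nonneg)
  then have s: "s > 0" "s\<^sup>2 = A\<^sup>2 + B\<^sup>2 + C\<^sup>2"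
    by (auto simp: s_def)
  have n: "(A / s)\<^sup>2 + (B / s)\<^sup>2 + (C / s)\<^sup>2 = 1"
    using s(2) pos by (simp add: power_divide flip: add_divide_distrib)
  have e: "c *s ac A B C = (c * s) *s ac (of_real (A / s)) (of_real (B / s)) (of_real (C / s))"
    using s(1) by (simp add: vec_eq_iff forall_3 ac_def field_simps)
  have "ac (of_real (A / s)) (of_real (B / s)) (of_real (C / s)) \<noteq> 0"
    using nz' unfolding e by auto
  then have "proj (c *s ac A B C) = proj (ac (of_real (A / s)) (of_real (B / s)) (of_real (C / s)))"
    unfolding e using assms(1) s(1) by (intro proj_scale) auto
  moreover have "proj (ac (of_real (A / s)) (of_real (B / s)) (of_real (C / s))) \<in> L_AC"
    unfolding L_AC_def ac_def
    by (rule CollectI, rule exI[of _ "A / s"], rule exI[of _ "B / s"], rule exI[of _ "C / s"]) (use n in \<open>auto simp del: abs_divide\<close>)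
  ultimately show "proj (c *s ac A B C) \<in> L_AC" by simp
qed

lemma ac_of_L_AC:
  assumes "w \<noteq> 0" "proj w \<in> L_AC"
  obtains c and A B C :: real where "w = c *s ac A B C"
proof -
  obtain A B C :: real where p: "proj w = proj (ac A B C)" and n: "\<bar>A\<bar>\<^sup>2 + \<bar>B\<bar>\<^sup>2 + \<bar>C\<bar>\<^sup>2 = 1"
    using assms(2) unfolding L_AC_def ac_def by blast
  have "ac A B C \<noteq> 0"
    using n by (intro ac_nonzero) auto
  then show ?thesis
    using that p proj_eq_iff[of "ac A B C" w] assms(1) by metis
qed

text \<open>If \<open>f\<close> and \<open>g\<close> have a real ratio and are real at \<open>x\<close>, then the imaginary parts of their derivatives
  are in the ratio \<open>a : b\<close>.\<close>

lemma real_ratio_derivative: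
  assumes f: "(f has_vector_derivative f') (at x)" "f x = complex_of_real a"
    and g: "(g has_vector_derivative g') (at x)" "g x = complex_of_real b"
    and real: "\<forall>\<^sub>F t in nhds x. Im (f t * cnj (g t)) = 0"
  shows "Im f' * b = a * Im g'"
proof -
  have "((\<lambda>t. f t * cnj (g t)) has_vector_derivative (f x * cnj g' + f' * cnj (g x))) (at x)"
    using f(1) g(1) by (intro has_vector_derivative_mult has_vector_derivative_cnj)
  then have "((\<lambda>t. Im (f t * cnj (g t))) has_vector_derivative Im (f x * cnj g' + f' * cnj (g x))) (at x)"
    by (rule bounded_linear.has_vector_derivative[OF bounded_linear_Im])
  from has_vector_derivative_eventually_zero[OF this real] show ?thesis
    by (simp add: f(2) g(2))
qed

text \<open>In the coordinates given by \<open>ac\<close> (and divided by \<open>c\<close>) the cone over \<open>L_AC\<close> consists of the complex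
  multiples of real vectors. At the real vector \<open>(A, B, C)\<close> a tangent vector has imaginary part
  proportional to \<open>(A, B, C)\<close>, since the ratios of the coordinates stay real. The hypothesis \<open>B \<noteq> 0\<close>
  makes \<open>(A, B, C)\<close>, \<open>(1, 0, 0)\<close>, \<open>(0, 0, 1)\<close> a basis.\<close>

lemma cone_tangent_L_AC:
  fixes A B C :: real
  assumes c: "c \<noteq> 0" and B: "B \<noteq> 0"
  defines "v \<equiv> c *s ac A B C"
  shows "cone_tangent L_AC v = span {v, \<i> *s v, c *s ac 1 0 0, c *s ac 0 0 1}" (is "?T = span ?S")
proof (intro subset_antisym subsetI)
  fix \<xi> assume "\<xi> \<in> ?T"
  then obtain \<gamma> where \<gamma>0: "\<gamma> 0 = v" and d: "(\<gamma> has_vector_derivative \<xi>) (at 0)"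
    and L: "\<forall>\<^sub>F t in nhds 0. \<gamma> t \<noteq> 0 \<and> proj (\<gamma> t) \<in> L_AC"
    unfolding cone_tangent_def by blast
  \<comment> \<open>The inverse of the map \<open>(P, Q, R) \<mapsto> c *s ac P Q R\<close>.\<close>
  define P where "P = (\<lambda>w::complex^3. (w $ 1 + w $ 3) / (2 * c))"
  define Q where "Q = (\<lambda>w::complex^3. (w $ 1 - w $ 3) / (2 * \<i> * c))"
  define R where "R = (\<lambda>w::complex^3. w $ 2 / (\<i> * of_real (sqrt 2) * c))"
  note defs = P_def Q_def R_def
  have PQR: "P (k *s ac x y z) = k / c * x" "Q (k *s ac x y z) = k / c * y" "R (k *s ac x y z) = k / c * z"
    for k x y z using c by (simp_all add: defs ac_def field_simps)
  have dP: "((\<lambda>t. P (\<gamma> t)) has_vector_derivative P \<xi>) (at 0)"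
    and dQ: "((\<lambda>t. Q (\<gamma> t)) has_vector_derivative Q \<xi>) (at 0)"
    and dR: "((\<lambda>t. R (\<gamma> t)) has_vector_derivative R \<xi>) (at 0)"
    unfolding defs
    by (intro has_vector_derivative_divide has_vector_derivative_add has_vector_derivative_diff
        has_vector_derivative_nth d)+
  have at0: "P (\<gamma> 0) = A" "Q (\<gamma> 0) = B" "R (\<gamma> 0) = C"
    using c unfolding \<gamma>0 v_def PQR by auto
  have "\<forall>\<^sub>F t in nhds 0. Im (P (\<gamma> t) * cnj (Q (\<gamma> t))) = 0 \<and> Im (R (\<gamma> t) * cnj (Q (\<gamma> t))) = 0"
    using L
  proof (rule eventually_mono)
    fix t assume t: "\<gamma> t \<noteq> 0 \<and> proj (\<gamma> t) \<in> L_AC"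
    then obtain k and a1 a2 a3 :: real where e: "\<gamma> t = k *s ac a1 a2 a3"
      using ac_of_L_AC by blast
    show "Im (P (\<gamma> t) * cnj (Q (\<gamma> t))) = 0 \<and> Im (R (\<gamma> t) * cnj (Q (\<gamma> t))) = 0"
    proof -
      have "(w * of_real x) * cnj (w * of_real y) = of_real ((cmod w)\<^sup>2 * x * y)" for w and x y :: real
        by (simp add: complex_norm_square del: of_real_power)
      then show ?thesis
        unfolding e PQR by (simp only: Im_complex_of_real)
    qed
  qed
  then have "\<forall>\<^sub>F t in nhds 0. Im (P (\<gamma> t) * cnj (Q (\<gamma> t))) = 0"
    and "\<forall>\<^sub>F t in nhds 0. Im (R (\<gamma> t) * cnj (Q (\<gamma> t))) = 0"
    by (auto elim: eventually_mono)
  then have im: "Im (P \<xi>) * B = A * Im (Q \<xi>)" "Im (R \<xi>) * B = C * Im (Q \<xi>)"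
    using real_ratio_derivative dP dQ dR at0 by blast+
  define \<beta> where "\<beta> = Im (Q \<xi>) / B"
  define \<alpha> where "\<alpha> = Re (Q \<xi>) / B"
  have "P \<xi> = (\<alpha> + \<i> * \<beta>) * A + (Re (P \<xi>) - \<alpha> * A)" "Q \<xi> = (\<alpha> + \<i> * \<beta>) * B"
    "R \<xi> = (\<alpha> + \<i> * \<beta>) * C + (Re (R \<xi>) - \<alpha> * C)"
    using im B by (auto simp: complex_eq_iff \<alpha>_def \<beta>_def field_simps)
  moreover have "\<xi> = c *s ac (P \<xi>) (Q \<xi>) (R \<xi>)"
    using c by (simp add: vec_eq_iff forall_3 ac_def defs field_simps)
  ultimately have "\<xi> = c *s ac ((\<alpha> + \<i> * \<beta>) * A + (Re (P \<xi>) - \<alpha> * A)) ((\<alpha> + \<i> * \<beta>) * B)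
      ((\<alpha> + \<i> * \<beta>) * C + (Re (R \<xi>) - \<alpha> * C))"
    by metis
  also have "\<dots> = \<alpha> *\<^sub>R v + \<beta> *\<^sub>R (\<i> *s v) + (Re (P \<xi>) - \<alpha> * A) *\<^sub>R (c *s ac 1 0 0)
      + (Re (R \<xi>) - \<alpha> * C) *\<^sub>R (c *s ac 0 0 1)"
    by (simp add: vec_eq_iff forall_3 ac_def v_def scaleR_conv_of_real[where 'a=complex] algebra_simps)
  also have "\<dots> \<in> span ?S"
    by (intro span_add span_scale span_base) auto
  finally show "\<xi> \<in> span ?S" .
next
  fix \<xi> assume "\<xi> \<in> span ?S"
  then have "\<exists>\<alpha> \<beta> s t. \<xi> - \<alpha> *\<^sub>R v - \<beta> *\<^sub>R (\<i> *s v) - s *\<^sub>R (c *s ac 1 0 0) - t *\<^sub>R (c *s ac 0 0 1) = 0"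
    by (simp only: span_breakdown_eq span_empty singleton_iff)
  then obtain \<alpha> \<beta> s t
    where \<xi>: "\<xi> = \<alpha> *\<^sub>R v + \<beta> *\<^sub>R (\<i> *s v) + s *\<^sub>R (c *s ac 1 0 0) + t *\<^sub>R (c *s ac 0 0 1)"
    by (simp only: diff_diff_eq right_minus_eq) blast
  \<comment> \<open>The imaginary multiple of \<open>v\<close> rotates the complex factor, the other three terms move the real vector. A
    complex parameter lets the curve be differentiated as a polynomial.\<close>
  define G where "G = (\<lambda>\<tau>::complex. (c * (1 + \<i> * \<beta> * \<tau>)) *s ac (A + \<tau> * (\<alpha> * A + s)) (B + \<tau> * (\<alpha> * B)) (C + \<tau> * (\<alpha> * C + t)))"
  have "((\<lambda>\<tau>. G (complex_of_real \<tau>)) has_vector_derivative \<xi>) (at 0)"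
  proof (rule has_vector_derivative_vec)
    fix k :: 3
    have "((\<lambda>\<tau>. G \<tau> $ k) has_field_derivative \<xi> $ k) (at (complex_of_real 0))"
      using exhaust_3[of k]
      by (elim disjE; simp add: G_def \<xi> v_def ac_def scaleR_conv_of_real[where 'a=complex])
        (auto intro!: derivative_eq_intros simp: algebra_simps)
    then show "((\<lambda>\<tau>. G (complex_of_real \<tau>) $ k) has_vector_derivative \<xi> $ k) (at 0)"
      by (rule has_vector_derivative_real_field)
  qed
  moreover have "\<forall>\<^sub>F \<tau> in nhds 0. G (complex_of_real \<tau>) \<noteq> 0 \<and> proj (G (complex_of_real \<tau>)) \<in> L_AC"
  proof -
    have "((\<lambda>\<tau>. B + \<tau> * (\<alpha> * B)) \<longlongrightarrow> B + 0 * (\<alpha> * B)) (nhds 0)"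
      by (intro tendsto_intros filterlim_ident)
    then have "\<forall>\<^sub>F \<tau> in nhds 0. B + \<tau> * (\<alpha> * B) \<noteq> 0"
      using B by (intro tendsto_imp_eventually_ne) auto
    then show ?thesis
    proof (rule eventually_mono)
      fix \<tau> :: real assume nz: "B + \<tau> * (\<alpha> * B) \<noteq> 0"
      have e: "G (complex_of_real \<tau>) = (c * (1 + \<i> * \<beta> * \<tau>)) *s ac (of_real (A + \<tau> * (\<alpha> * A + s)))
          (of_real (B + \<tau> * (\<alpha> * B))) (of_real (C + \<tau> * (\<alpha> * C + t)))"
        by (simp add: G_def)
      have "1 + \<i> * complex_of_real \<beta> * complex_of_real \<tau> \<noteq> 0"
        by (auto simp: complex_eq_iff)
      with c have k: "c * (1 + \<i> * \<beta> * \<tau>) \<noteq> 0"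
        by simp
      show "G (complex_of_real \<tau>) \<noteq> 0 \<and> proj (G (complex_of_real \<tau>)) \<in> L_AC"
        unfolding e using k nz by (intro proj_ac_in_L_AC) auto
    qed
  qed
  moreover have "G (complex_of_real 0) = v"
    by (simp add: G_def v_def)
  ultimately show "\<xi> \<in> ?T"
    unfolding cone_tangent_def mem_Collect_eq
    by (intro exI[of _ "\<lambda>\<tau>. G (complex_of_real \<tau>)"] conjI)
qed

lemma sgn_of_real_mult: "r > 0 \<Longrightarrow> sgn (complex_of_real r * w) = sgn w"
  by (simp add: sgn_mult sgn_of_real)

text \<open>All three vectors are \<open>c\<close> times images of real vectors, and the determinant of \<open>ac\<close> is real; so
  the volume is a real multiple of \<open>c\<^sup>3\<close>.\<close>

lemma squared_phase_L_AC:
  fixes A B C :: real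
  assumes c: "c \<noteq> 0" and B: "B \<noteq> 0"
  shows "squared_phase L_AC (c *s ac A B C) (sgn (c ^ 6))"
proof -
  have "vol2 (c *s ac A B C) (c *s ac 1 0 0) (c *s ac 0 0 1) = of_real (2 * sqrt 2 * B) * c ^ 3"
    by (simp add: vol2_def det_3 ac_def algebra_simps power3_eq_cube)
  then have "vol2 (c *s ac A B C) (c *s ac 1 0 0) (c *s ac 0 0 1) \<noteq> 0"
    and "(vol2 (c *s ac A B C) (c *s ac 1 0 0) (c *s ac 0 0 1))\<^sup>2 = of_real ((2 * sqrt 2 * B)\<^sup>2) * c ^ 6"
    using c B by (auto simp: power_mult_distrib sqrt2_square)
  moreover have "sgn (of_real ((2 * sqrt 2 * B)\<^sup>2) * c ^ 6) = sgn (c ^ 6)"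
    using B by (intro sgn_of_real_mult) auto
  ultimately show ?thesis
    unfolding squared_phase_def using cone_tangent_L_AC[OF c B] by metis
qed

section \<open>The correspondence and its squared phase\<close>

definition sqnorm2 :: "complex \<Rightarrow> complex \<Rightarrow> complex" where "sqnorm2 a b = a * cnj a + b * cnj b"

lemma sqnorm2_nonzero:
  assumes "(a, b) \<noteq> (0, 0)"
  shows "sqnorm2 a b \<noteq> 0"
proof -
  have "sqnorm2 a b = of_real ((cmod a)\<^sup>2 + (cmod b)\<^sup>2)"
    by (simp add: sqnorm2_def complex_norm_square del: of_real_power)
  moreover have "(cmod a)\<^sup>2 + (cmod b)\<^sup>2 \<noteq> 0"
    using assms by (auto simp: sum_power2_eq_zero_iff)
  ultimately show ?thesis by (simp only: of_real_eq_0_iff) simp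
qed

text \<open>The vectors \<open>(a, b)\<close> and \<open>(- cnj b, cnj a)\<close> are orthogonal and have equal norms.\<close>

lemma hermitian_frame_expansion:
  fixes a b x y :: complex
  assumes "sqnorm2 a b \<noteq> 0"
  defines "s \<equiv> (x * cnj a + y * cnj b) / sqnorm2 a b" and "t \<equiv> (a * y - b * x) / sqnorm2 a b"
  shows "x = s * a - t * cnj b" "y = s * b + t * cnj a"
proof -
  have "s * a - t * cnj b
      = ((x * cnj a + y * cnj b) * a - (a * y - b * x) * cnj b) / sqnorm2 a b"
    unfolding s_def t_def by (simp only: times_divide_eq_left flip: diff_divide_distrib)
  also have "(x * cnj a + y * cnj b) * a - (a * y - b * x) * cnj b = x * sqnorm2 a b"
    by (simp add: sqnorm2_def algebra_simps)
  finally show "x = s * a - t * cnj b"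
    using assms(1) by simp
  have "s * b + t * cnj a = ((x * cnj a + y * cnj b) * b + (a * y - b * x) * cnj a) / sqnorm2 a b"
    unfolding s_def t_def by (simp only: times_divide_eq_left flip: add_divide_distrib)
  also have "(x * cnj a + y * cnj b) * b + (a * y - b * x) * cnj a = y * sqnorm2 a b"
    by (simp add: sqnorm2_def algebra_simps)
  finally show "y = s * b + t * cnj a"
    using assms(1) by simp
qed

lemma proj_in_Lambda_S1:
  assumes "c \<noteq> 0" "d \<noteq> 0" "(X, Y) \<noteq> (0, 0)" "2 * (cmod Z)\<^sup>2 = (cmod X)\<^sup>2 + (cmod Y)\<^sup>2"
  shows "c *s vector [X, Y] \<noteq> (0 :: complex^2) \<and> d *s vector [X, Y, Z] \<noteq> (0 :: complex^3) \<and>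
    (proj (c *s vector [X, Y]), proj (d *s vector [X, Y, Z])) \<in> Lambda_S1"
proof -
  have nz: "(vector [X, Y] :: complex^2) \<noteq> 0" "(vector [X, Y, Z] :: complex^3) \<noteq> 0"
    "c *s vector [X, Y] \<noteq> (0 :: complex^2)" "d *s vector [X, Y, Z] \<noteq> (0 :: complex^3)"
    using assms by (auto simp: vec_eq_iff forall_2 forall_3)
  have "(proj (vector [X, Y]), proj (vector [X, Y, Z])) \<in> Lambda_S1"
    using assms(3,4) unfolding Lambda_S1_def by blast
  with nz assms(1,2) show ?thesis
    by (simp add: proj_scale)
qed

lemma Lambda_S1_equations:
  fixes p :: "complex^2" and q :: "complex^3"
  assumes "p \<noteq> 0" "q \<noteq> 0" "(proj p, proj q) \<in> Lambda_S1"
  shows "p $ 1 * q $ 2 - p $ 2 * q $ 1 = 0"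
    and "2 * (q $ 3 * cnj (q $ 3)) - sqnorm2 (q $ 1) (q $ 2) = 0"
proof -
  obtain X Y Z where *: "(X, Y) \<noteq> (0, 0)" "2 * (cmod Z)\<^sup>2 = (cmod X)\<^sup>2 + (cmod Y)\<^sup>2"
    "proj p = proj (vector [X, Y])" "proj q = proj (vector [X, Y, Z])"
    using assms(3) unfolding Lambda_S1_def by auto
  have nz: "(vector [X, Y] :: complex^2) \<noteq> 0" "(vector [X, Y, Z] :: complex^3) \<noteq> 0"
    using *(1) by (auto simp: vec_eq_iff forall_2 forall_3)
  obtain c d where "p = c *s vector [X, Y]" "q = d *s vector [X, Y, Z]"
    using *(3,4) proj_eq_iff[OF nz(1) assms(1)] proj_eq_iff[OF nz(2) assms(2)] by metis
  then have pq: "p $ 1 = c * X" "p $ 2 = c * Y" "q $ 1 = d * X" "q $ 2 = d * Y" "q $ 3 = d * Z"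
    by simp_all
  have "2 * (Z * cnj Z) = sqnorm2 X Y"
    using arg_cong[OF *(2), of complex_of_real]
    by (simp add: sqnorm2_def complex_norm_square del: of_real_power)
  then have "d * cnj d * (2 * (Z * cnj Z)) = d * cnj d * sqnorm2 X Y" by simp
  then show "2 * (q $ 3 * cnj (q $ 3)) - sqnorm2 (q $ 1) (q $ 2) = 0"
    by (simp add: pq sqnorm2_def algebra_simps)
  show "p $ 1 * q $ 2 - p $ 2 * q $ 1 = 0"
    by (simp add: pq)
qed

text \<open>The cone over \<open>Lambda_S1\<close> is cut out by the equations \<open>p\<^sub>1 q\<^sub>2 = p\<^sub>2 q\<^sub>1\<close> and
  \<open>2 \<bar>q\<^sub>3\<bar>\<^sup>2 = \<bar>q\<^sub>1\<bar>\<^sup>2 + \<bar>q\<^sub>2\<bar>\<^sup>2\<close>. Besides the complex multiples of \<open>p\<close> and \<open>q\<close>, its tangent space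
  contains the two directions \<open>\<xi>\<close>, \<open>\<eta>\<close> that move \<open>[a : b]\<close> orthogonally to \<open>(a, b)\<close>, simultaneously in
  both factors, and the direction \<open>\<zeta>\<close> of the circle action. Only the case of equal first two
  coordinates in both factors is considered; every point of the correspondence has such
  homogeneous coordinates.\<close>

lemma cone_tangent2_Lambda_S1:
  fixes a b Z :: complex
  assumes ab: "(a, b) \<noteq> (0, 0)" and Z: "2 * (cmod Z)\<^sup>2 = (cmod a)\<^sup>2 + (cmod b)\<^sup>2"
  defines "p \<equiv> vector [a, b] :: complex^2" and "q \<equiv> vector [a, b, Z] :: complex^3"
    and "\<xi> \<equiv> (vector [- cnj b, cnj a] :: complex^2, vector [- cnj b, cnj a, 0] :: complex^3)"
    and "\<eta> \<equiv> (vector [- \<i> * cnj b, \<i> * cnj a] :: complex^2, vector [- \<i> * cnj b, \<i> * cnj a, 0] :: complex^3)"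
    and "\<zeta> \<equiv> (0 :: complex^2, vector [0, 0, \<i> * Z] :: complex^3)"
  shows "cone_tangent2 Lambda_S1 (p, q) = span {(p, 0), (\<i> *s p, 0), (0, q), (0, \<i> *s q), \<xi>, \<eta>, \<zeta>}"
    (is "?T = span ?S")
proof (intro subset_antisym subsetI)
  have N: "sqnorm2 a b \<noteq> 0" by (rule sqnorm2_nonzero[OF ab])
  have NZ: "2 * (Z * cnj Z) = sqnorm2 a b"
    using arg_cong[OF Z, of complex_of_real]
    by (simp add: sqnorm2_def complex_norm_square del: of_real_power)
  have Z0: "Z \<noteq> 0" using N NZ by auto
  fix x assume "x \<in> ?T"
  then obtain \<gamma> where \<gamma>0: "\<gamma> 0 = (p, q)" and d: "(\<gamma> has_vector_derivative x) (at 0)"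
    and L: "\<forall>\<^sub>F t in nhds 0. fst (\<gamma> t) \<noteq> 0 \<and> snd (\<gamma> t) \<noteq> 0 \<and> (proj (fst (\<gamma> t)), proj (snd (\<gamma> t))) \<in> Lambda_S1"
    unfolding cone_tangent2_def by blast
  have eq: "\<forall>\<^sub>F t in nhds 0. fst (\<gamma> t) $ 1 * snd (\<gamma> t) $ 2 - fst (\<gamma> t) $ 2 * snd (\<gamma> t) $ 1 = 0"
    "\<forall>\<^sub>F t in nhds 0. 2 * (snd (\<gamma> t) $ 3 * cnj (snd (\<gamma> t) $ 3)) - sqnorm2 (snd (\<gamma> t) $ 1) (snd (\<gamma> t) $ 2) = 0"
    using L by (rule eventually_mono; use Lambda_S1_equations in blast)+
  define \<alpha> where "\<alpha> = fst x"
  define \<beta> where "\<beta> = snd x"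
  have df: "((\<lambda>t. fst (\<gamma> t) $ k) has_vector_derivative \<alpha> $ k) (at 0)" for k
    unfolding \<alpha>_def by (intro has_vector_derivative_nth bounded_linear.has_vector_derivative[OF bounded_linear_fst d])
  have ds: "((\<lambda>t. snd (\<gamma> t) $ k) has_vector_derivative \<beta> $ k) (at 0)" for k
    unfolding \<beta>_def by (intro has_vector_derivative_nth bounded_linear.has_vector_derivative[OF bounded_linear_snd d])
  note at0 = \<gamma>0 p_def q_def vector_2 vector_3 fst_conv snd_conv
  have "((\<lambda>t. fst (\<gamma> t) $ 1 * snd (\<gamma> t) $ 2 - fst (\<gamma> t) $ 2 * snd (\<gamma> t) $ 1) has_vector_derivative
      (a * \<beta> $ 2 + \<alpha> $ 1 * b) - (b * \<beta> $ 1 + \<alpha> $ 2 * a)) (at 0)"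
    using has_vector_derivative_diff[OF has_vector_derivative_mult[OF df[of 1] ds[of 2]]
        has_vector_derivative_mult[OF df[of 2] ds[of 1]]]
    by (simp add: at0)
  then have e1: "(a * \<beta> $ 2 + \<alpha> $ 1 * b) - (b * \<beta> $ 1 + \<alpha> $ 2 * a) = 0"
    by (rule has_vector_derivative_eventually_zero[OF _ eq(1)])
  have dn: "((\<lambda>t. snd (\<gamma> t) $ k * cnj (snd (\<gamma> t) $ k)) has_vector_derivative
      (q $ k * cnj (\<beta> $ k) + \<beta> $ k * cnj (q $ k))) (at 0)" for k
    using has_vector_derivative_mult[OF ds[of k] has_vector_derivative_cnj[OF ds[of k]]] by (simp add: \<gamma>0)
  have "((\<lambda>t. 2 * (snd (\<gamma> t) $ 3 * cnj (snd (\<gamma> t) $ 3)) - sqnorm2 (snd (\<gamma> t) $ 1) (snd (\<gamma> t) $ 2)) has_vector_derivative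
      2 * (Z * cnj (\<beta> $ 3) + \<beta> $ 3 * cnj Z) - ((a * cnj (\<beta> $ 1) + \<beta> $ 1 * cnj a) + (b * cnj (\<beta> $ 2) + \<beta> $ 2 * cnj b))) (at 0)"
    using has_vector_derivative_diff[OF has_vector_derivative_mult_right[OF dn[of 3], of 2]
        has_vector_derivative_add[OF dn[of 1] dn[of 2]]]
    unfolding sqnorm2_def by (simp only: q_def vector_3)
  then have e2: "2 * (Z * cnj (\<beta> $ 3) + \<beta> $ 3 * cnj Z) - ((a * cnj (\<beta> $ 1) + \<beta> $ 1 * cnj a) + (b * cnj (\<beta> $ 2) + \<beta> $ 2 * cnj b)) = 0"
    by (rule has_vector_derivative_eventually_zero[OF _ eq(2)])
  define s where "s = (\<alpha> $ 1 * cnj a + \<alpha> $ 2 * cnj b) / sqnorm2 a b"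
  define s' where "s' = (\<beta> $ 1 * cnj a + \<beta> $ 2 * cnj b) / sqnorm2 a b"
  define t where "t = (a * \<alpha> $ 2 - b * \<alpha> $ 1) / sqnorm2 a b"
  \<comment> \<open>The part of the third coordinate not explained by rescaling \<open>q\<close>; the second equation forces it to be
    imaginary, that is, a rotation by the circle.\<close>
  define u where "u = \<beta> $ 3 / Z - s'"
  have t': "t = (a * \<beta> $ 2 - b * \<beta> $ 1) / sqnorm2 a b"
    unfolding t_def using e1 by (simp add: algebra_simps)
  have \<alpha>: "\<alpha> $ 1 = s * a - t * cnj b" "\<alpha> $ 2 = s * b + t * cnj a"
    unfolding s_def t_def by (rule hermitian_frame_expansion[OF N])+
  have \<beta>: "\<beta> $ 1 = s' * a - t * cnj b" "\<beta> $ 2 = s' * b + t * cnj a"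
    unfolding s'_def t' by (rule hermitian_frame_expansion[OF N])+
  have \<beta>3: "\<beta> $ 3 = Z * (s' + u)"
    unfolding u_def using Z0 by simp
  have "(a * cnj (\<beta> $ 1) + \<beta> $ 1 * cnj a) + (b * cnj (\<beta> $ 2) + \<beta> $ 2 * cnj b) = sqnorm2 a b * (s' + cnj s')"
    unfolding \<beta> sqnorm2_def by (simp add: algebra_simps)
  moreover have "2 * (Z * cnj (\<beta> $ 3) + \<beta> $ 3 * cnj Z) = (2 * (Z * cnj Z)) * (s' + cnj s' + (u + cnj u))"
    unfolding \<beta>3 by (simp add: algebra_simps)
  ultimately have "sqnorm2 a b * (u + cnj u) = 0"
    using e2 unfolding NZ by (simp add: algebra_simps)
  with N have u: "Re u = 0"
    by (simp add: complex_add_cnj)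
  have "x = Re s *\<^sub>R (p, 0) + Im s *\<^sub>R (\<i> *s p, 0) + Re s' *\<^sub>R (0, q) + Im s' *\<^sub>R (0, \<i> *s q)
      + Re t *\<^sub>R \<xi> + Im t *\<^sub>R \<eta> + Im u *\<^sub>R \<zeta>"
  proof (rule prod_eqI)
    note defs = p_def q_def \<xi>_def \<eta>_def \<zeta>_def
    show "fst x = fst (Re s *\<^sub>R (p, 0) + Im s *\<^sub>R (\<i> *s p, 0) + Re s' *\<^sub>R (0, q) + Im s' *\<^sub>R (0, \<i> *s q)
      + Re t *\<^sub>R \<xi> + Im t *\<^sub>R \<eta> + Im u *\<^sub>R \<zeta>)"
      unfolding \<alpha>_def[symmetric] vec_eq_iff forall_2 \<alpha>
      by (simp add: defs complex_eq_iff algebra_simps)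
    show "snd x = snd (Re s *\<^sub>R (p, 0) + Im s *\<^sub>R (\<i> *s p, 0) + Re s' *\<^sub>R (0, q) + Im s' *\<^sub>R (0, \<i> *s q)
      + Re t *\<^sub>R \<xi> + Im t *\<^sub>R \<eta> + Im u *\<^sub>R \<zeta>)"
      unfolding \<beta>_def[symmetric] vec_eq_iff forall_3 \<beta> \<beta>3
      using u by (simp add: defs complex_eq_iff algebra_simps)
  qed
  also have "\<dots> \<in> span ?S"
    by (intro span_add span_scale span_base) auto
  finally show "x \<in> span ?S" .
next
  fix x assume "x \<in> span ?S"
  then have "\<exists>s1 s2 r1 r2 t1 t2 m. x - s1 *\<^sub>R (p, 0) - s2 *\<^sub>R (\<i> *s p, 0) - r1 *\<^sub>R (0, q)
      - r2 *\<^sub>R (0, \<i> *s q) - t1 *\<^sub>R \<xi> - t2 *\<^sub>R \<eta> - m *\<^sub>R \<zeta> = 0"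
    unfolding span_breakdown_eq span_empty singleton_iff .
  then obtain s1 s2 r1 r2 t1 t2 m where "x - s1 *\<^sub>R (p, 0) - s2 *\<^sub>R (\<i> *s p, 0) - r1 *\<^sub>R (0, q)
      - r2 *\<^sub>R (0, \<i> *s q) - t1 *\<^sub>R \<xi> - t2 *\<^sub>R \<eta> - m *\<^sub>R \<zeta> = 0"
    by (elim exE)
  then have x: "x = s1 *\<^sub>R (p, 0) + s2 *\<^sub>R (\<i> *s p, 0) + r1 *\<^sub>R (0, q)
      + r2 *\<^sub>R (0, \<i> *s q) + t1 *\<^sub>R \<xi> + t2 *\<^sub>R \<eta> + m *\<^sub>R \<zeta>"
    by (simp only: diff_diff_eq right_minus_eq)
  define s where "s = Complex s1 s2"
  define r where "r = Complex r1 r2"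
  define t where "t = Complex t1 t2"
  \<comment> \<open>Moving \<open>(a, b)\<close> along a great circle instead of a straight line keeps its norm constant, so that the
    third coordinate only has to rotate. If \<open>t = 0\<close>, then \<open>\<sigma> = 0\<close> and \<open>(a, b)\<close> stays fixed.\<close>
  define \<sigma> where "\<sigma> = sgn t"
  define X where "X = (\<lambda>\<tau>::complex. cos (cmod t * \<tau>) * a - sin (cmod t * \<tau>) * \<sigma> * cnj b)"
  define Y where "Y = (\<lambda>\<tau>::complex. cos (cmod t * \<tau>) * b + sin (cmod t * \<tau>) * \<sigma> * cnj a)"
  define W where "W = (\<lambda>\<tau>::complex. Z * exp (\<i> * m * \<tau>))"
  define P where "P = (\<lambda>\<tau>::complex. (1 + s * \<tau>) *s (vector [X \<tau>, Y \<tau>] :: complex^2))"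
  define Q where "Q = (\<lambda>\<tau>::complex. (1 + r * \<tau>) *s (vector [X \<tau>, Y \<tau>, W \<tau>] :: complex^3))"
  have t\<sigma>: "of_real (cmod t) * \<sigma> = t"
    unfolding \<sigma>_def sgn_eq by simp
  have dX: "(X has_field_derivative - t * cnj b) (at 0)" and dY: "(Y has_field_derivative t * cnj a) (at 0)"
    and dW: "(W has_field_derivative \<i> * m * Z) (at 0)"
    using t\<sigma> unfolding X_def Y_def W_def by (auto intro!: derivative_eq_intros)
  have XYW0: "X 0 = a" "Y 0 = b" "W 0 = Z"
    by (simp_all add: X_def Y_def W_def)
  have x1: "fst x $ 1 = s * a - t * cnj b" "fst x $ 2 = s * b + t * cnj a"
    and x2: "snd x $ 1 = r * a - t * cnj b" "snd x $ 2 = r * b + t * cnj a" "snd x $ 3 = r * Z + \<i> * m * Z"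
    unfolding x by (simp_all add: p_def q_def \<xi>_def \<eta>_def \<zeta>_def s_def r_def t_def Complex_eq scaleR_conv_of_real[where 'a=complex] algebra_simps)
  have dP: "((\<lambda>\<tau>. P (complex_of_real \<tau>)) has_vector_derivative fst x) (at 0)"
  proof (rule has_vector_derivative_vec)
    fix k :: 2
    have "((\<lambda>\<tau>. P \<tau> $ k) has_field_derivative fst x $ k) (at (complex_of_real 0))"
      using exhaust_2[of k]
      by (elim disjE; simp add: P_def x1)
        (auto intro!: derivative_eq_intros dX dY simp: XYW0)
    then show "((\<lambda>\<tau>. P (complex_of_real \<tau>) $ k) has_vector_derivative fst x $ k) (at 0)"
      by (rule has_vector_derivative_real_field)
  qed
  have dQ: "((\<lambda>\<tau>. Q (complex_of_real \<tau>)) has_vector_derivative snd x) (at 0)"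
  proof (rule has_vector_derivative_vec)
    fix k :: 3
    have "((\<lambda>\<tau>. Q \<tau> $ k) has_field_derivative snd x $ k) (at (complex_of_real 0))"
      using exhaust_3[of k]
      by (elim disjE; simp add: Q_def x2)
        (auto intro!: derivative_eq_intros dX dY dW simp: XYW0)
    then show "((\<lambda>\<tau>. Q (complex_of_real \<tau>) $ k) has_vector_derivative snd x $ k) (at 0)"
      by (rule has_vector_derivative_real_field)
  qed
  have "((\<lambda>\<tau>. (P (complex_of_real \<tau>), Q (complex_of_real \<tau>))) has_vector_derivative x) (at 0)"
    using has_vector_derivative_Pair[OF dP dQ] by simp
  moreover have "(P (complex_of_real 0), Q (complex_of_real 0)) = (p, q)"
    by (simp add: P_def Q_def XYW0 p_def q_def)
  moreover have "\<forall>\<^sub>F \<tau> in nhds 0. P (complex_of_real \<tau>) \<noteq> 0 \<and> Q (complex_of_real \<tau>) \<noteq> 0 \<and>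
      (proj (P (complex_of_real \<tau>)), proj (Q (complex_of_real \<tau>))) \<in> Lambda_S1"
  proof -
    have nz: "\<forall>\<^sub>F \<tau> in nhds 0. 1 + w * complex_of_real \<tau> \<noteq> 0" for w
    proof (rule tendsto_imp_eventually_ne)
      show "((\<lambda>\<tau>. 1 + w * complex_of_real \<tau>) \<longlongrightarrow> 1 + w * of_real 0) (nhds 0)"
        by (intro tendsto_intros filterlim_ident)
    qed simp
    show ?thesis
      using nz[of s] nz[of r]
    proof (rule eventually_elim2)
      fix \<tau> :: real
      assume 1: "1 + s * complex_of_real \<tau> \<noteq> 0" and 2: "1 + r * complex_of_real \<tau> \<noteq> 0"
      define C S where "C = complex_of_real (cos (cmod t * \<tau>))" and "S = complex_of_real (sin (cmod t * \<tau>))"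
      have CS: "C * C + S * S * (\<sigma> * cnj \<sigma>) = 1"
      proof (cases "t = 0")
        case False
        then have "\<sigma> * cnj \<sigma> = 1"
          by (simp add: \<sigma>_def norm_sgn flip: complex_norm_square)
        moreover have "C * C + S * S = 1"
          unfolding C_def S_def of_real_mult[symmetric] of_real_add[symmetric]
          using sin_cos_squared_add3[of "cmod t * \<tau>"] by simp
        ultimately show ?thesis by simp
      qed (simp add: C_def S_def)
      have XY: "X \<tau> = C * a - S * \<sigma> * cnj b" "Y \<tau> = C * b + S * \<sigma> * cnj a"
        unfolding X_def Y_def C_def S_def by (simp_all flip: cos_of_real sin_of_real)
      have [simp]: "cnj C = C" "cnj S = S"
        by (simp_all add: C_def S_def)
      have "sqnorm2 (X \<tau>) (Y \<tau>) = (C * C + S * S * (\<sigma> * cnj \<sigma>)) * sqnorm2 a b"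
        unfolding XY sqnorm2_def by (simp add: algebra_simps)
      then have n: "sqnorm2 (X \<tau>) (Y \<tau>) = sqnorm2 a b"
        unfolding CS by simp
      have nc: "sqnorm2 v w = of_real ((cmod v)\<^sup>2 + (cmod w)\<^sup>2)" for v w
        by (simp add: sqnorm2_def complex_norm_square del: of_real_power)
      have "(cmod (X \<tau>))\<^sup>2 + (cmod (Y \<tau>))\<^sup>2 = (cmod a)\<^sup>2 + (cmod b)\<^sup>2"
        using n unfolding nc by (simp only: of_real_eq_iff)
      moreover have "cmod (W \<tau>) = cmod Z"
        by (simp add: W_def norm_mult)
      moreover have "(X \<tau>, Y \<tau>) \<noteq> (0, 0)"
        using n sqnorm2_nonzero[OF ab] by (auto simp: sqnorm2_def)
      ultimately show "P (complex_of_real \<tau>) \<noteq> 0 \<and> Q (complex_of_real \<tau>) \<noteq> 0 \<and>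
          (proj (P (complex_of_real \<tau>)), proj (Q (complex_of_real \<tau>))) \<in> Lambda_S1"
        unfolding P_def Q_def using Z by (intro proj_in_Lambda_S1 1 2) auto
    qed
  qed
  ultimately show "x \<in> ?T"
    unfolding cone_tangent2_def mem_Collect_eq
    by (intro exI[of _ "\<lambda>\<tau>. (P (complex_of_real \<tau>), Q (complex_of_real \<tau>))"]) simp
qed

text \<open>On the frame above, the volume form takes the value \<open>- 2 (\<bar>a\<bar>\<^sup>2 + \<bar>b\<bar>\<^sup>2)\<^sup>2 Z\<close>.\<close>

lemma squared_phase2_Lambda_S1:
  assumes ab: "(a, b) \<noteq> (0, 0)" and Z: "2 * (cmod Z)\<^sup>2 = (cmod a)\<^sup>2 + (cmod b)\<^sup>2"
  shows "squared_phase2 Lambda_S1 (vector [a, b], vector [a, b, Z]) (sgn (Z\<^sup>2))"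
proof -
  define p q where "p = (vector [a, b] :: complex^2)" and "q = (vector [a, b, Z] :: complex^3)"
  define \<xi> where "\<xi> = (vector [- cnj b, cnj a] :: complex^2, vector [- cnj b, cnj a, 0] :: complex^3)"
  define \<eta> where "\<eta> = (vector [- \<i> * cnj b, \<i> * cnj a] :: complex^2, vector [- \<i> * cnj b, \<i> * cnj a, 0] :: complex^3)"
  define \<zeta> where "\<zeta> = (0 :: complex^2, vector [0, 0, \<i> * Z] :: complex^3)"
  define n where "n = (cmod a)\<^sup>2 + (cmod b)\<^sup>2"
  have n: "sqnorm2 a b = of_real n"
    by (simp add: sqnorm2_def n_def complex_norm_square del: of_real_power)
  have n0: "n \<noteq> 0" using sqnorm2_nonzero[OF ab] n by auto
  have Z0: "Z \<noteq> 0" using Z n0 by (auto simp: n_def)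
  have "vol12 (p, q) \<xi> \<eta> \<zeta> = -2 * (sqnorm2 a b)\<^sup>2 * Z"
    by (simp add: vol12_def vol1_def vol2_def p_def q_def \<xi>_def \<eta>_def \<zeta>_def det_2 det_3 sqnorm2_def
        algebra_simps power2_eq_square)
  then have v: "vol12 (p, q) \<xi> \<eta> \<zeta> = of_real (-2 * n\<^sup>2) * Z"
    by (simp add: n)
  then have sq: "(vol12 (p, q) \<xi> \<eta> \<zeta>)\<^sup>2 = of_real ((-2 * n\<^sup>2)\<^sup>2) * Z\<^sup>2"
    by (simp add: power_mult_distrib)
  have "sgn ((vol12 (p, q) \<xi> \<eta> \<zeta>)\<^sup>2) = sgn (Z\<^sup>2)"
    unfolding sq by (rule sgn_of_real_mult) (use n0 in simp)
  moreover have "vol12 (p, q) \<xi> \<eta> \<zeta> \<noteq> 0"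
    unfolding v using n0 Z0 by simp
  ultimately show ?thesis
    using cone_tangent2_Lambda_S1[OF ab Z]
    unfolding squared_phase2_def p_def q_def \<xi>_def \<eta>_def \<zeta>_def fst_conv snd_conv by metis
qed

section \<open>The quilted Maslov index\<close>

lemma cis_arctan:
  assumes "k > 0"
  shows "cis (arctan (x / k)) = sgn (of_real k + \<i> * of_real x)"
proof -
  have "sqrt (1 + (x / k)\<^sup>2) = sqrt (k\<^sup>2 + x\<^sup>2) / k"
    using assms by (simp add: real_sqrt_divide[symmetric] power_divide add_divide_distrib
        flip: real_sqrt_abs) (simp add: field_simps real_sqrt_divide)
  then show ?thesis
    using assms by (simp add: complex_eq_iff sgn_eq cos_arctan sin_arctan cmod_def)
qed

lemma sgn_power_complex: "sgn (w ^ n) = sgn (w :: complex) ^ n"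
  by (induction n) (simp_all add: sgn_mult)

lemma arctan_div_tendsto:
  assumes "k > 0"
  shows "((\<lambda>x. arctan (x / k)) \<longlongrightarrow> - (pi / 2)) at_bot" "((\<lambda>x. arctan (x / k)) \<longlongrightarrow> pi / 2) at_top"
  using assms by (real_asymp simp: field_simps)+

lemma tendsto_affine_ratio_at_infinity:
  fixes b c :: complex
  shows "((\<lambda>z. (z + b) / (z + c)) \<longlongrightarrow> 1) at_infinity"
proof -
  have "filterlim (\<lambda>z. z + c) at_infinity at_infinity"
    using tendsto_add_filterlim_at_infinity'[OF filterlim_ident tendsto_const] .
  then have "((\<lambda>z. 1 + (b - c) / (z + c)) \<longlongrightarrow> 1 + 0) at_infinity"
    by (intro tendsto_add tendsto_const tendsto_divide_0[OF tendsto_const])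
  moreover have "\<forall>\<^sub>F z in at_infinity. 1 + (b - c) / (z + c) = (z + b) / (z + c)"
    using eventually_not_equal_at_infinity[of "-c"]
    by (rule eventually_mono) (auto simp: field_simps eq_neg_iff_add_eq_0)
  ultimately show ?thesis
    by (simp add: tendsto_cong)
qed

lemma liftsI:
  assumes "\<And>k. continuous_on S (\<lambda>z. v z $ k)" "\<And>z. z \<in> S \<Longrightarrow> v z \<noteq> 0" "\<And>z. z \<in> S \<Longrightarrow> u z = proj (v z)"
    and "l \<noteq> 0" "\<And>k. ((\<lambda>z. v z $ k) \<longlongrightarrow> l $ k) at_infinity"
  shows "lifts S u v"
proof -
  have "continuous_on S (\<lambda>z. \<chi> k. v z $ k)"
    by (intro continuous_on_vec_lambda assms)
  then have "continuous_on S v" by simp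
  moreover have "(v \<longlongrightarrow> l) (inf at_infinity (principal S))"
    by (intro vec_tendstoI tendsto_mono[OF inf_le1 assms(5)])
  ultimately show ?thesis
    unfolding lifts_def using assms by blast
qed

text \<open>The lifts are the given homogeneous coordinates divided by \<open>z + 6 \<i>\<close>, whose zero lies outside both
  patches. Then the lifts agree in their first two coordinates along the seam. The phases are
  computed from \<open>1 / (x + 6 \<i>) = - \<i> (6 + \<i> x) / (x\<^sup>2 + 36)\<close> on the boundary and from
  \<open>(x - 5 \<i>) / (x + 7 \<i>) = - (5 + \<i> x) (7 + \<i> x) / (x\<^sup>2 + 49)\<close> on the seam, together with
  \<open>arg (k + \<i> x) = arctan (x / k)\<close>.\<close>

lemma quilted_maslov_index_u:
  fixes e :: real
  assumes e: "e\<^sup>2 = 1"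
  shows "has_quilted_maslov_index Lambda_S1 L_AC
    (\<lambda>z. proj (vector [of_real e * (z + 6 * \<i>), \<i> * z]))
    (\<lambda>z. proj (vector [of_real e * (z + 6 * \<i>), \<i> * z, of_real e * (z - 6 * \<i>)])) 1"
proof -
  let ?w = "\<lambda>z. vector [of_real e * (z + 6 * \<i>), \<i> * z, of_real e * (z - 6 * \<i>)] :: complex^3"
  define v1 where "v1 = (\<lambda>z. vector [of_real e, \<i> * (z / (z + 6 * \<i>))] :: complex^2)"
  define v2 where "v2 = (\<lambda>z. vector [of_real e, \<i> * (z / (z + 6 * \<i>)), of_real e * ((z - 6 * \<i>) / (z + 6 * \<i>))] :: complex^3)"
  have e0: "e \<noteq> 0" using e by auto
  have nz: "z + 6 * \<i> \<noteq> 0" if "Im z \<ge> 0" for z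
    using that by (auto simp: complex_eq_iff)
  have v1: "v1 z = (1 / (z + 6 * \<i>)) *s vector [of_real e * (z + 6 * \<i>), \<i> * z]" if "Im z \<ge> 0" for z
    using nz[OF that] by (simp add: v1_def vec_eq_iff forall_2)
  have v2: "v2 z = (1 / (z + 6 * \<i>)) *s ?w z" if "Im z \<ge> 0" for z
    using nz[OF that] by (simp add: v2_def vec_eq_iff forall_3)
  have c1: "continuous_on S (\<lambda>z. v1 z $ k)" if "\<And>z. z \<in> S \<Longrightarrow> Im z \<ge> 0" for S k
    using exhaust_2[of k] nz[OF that] by (elim disjE) (auto simp: v1_def intro!: continuous_intros)
  have c2: "continuous_on S (\<lambda>z. v2 z $ k)" if "\<And>z. z \<in> S \<Longrightarrow> Im z \<ge> 0" for S k
    using exhaust_3[of k] nz[OF that] by (elim disjE) (auto simp: v2_def intro!: continuous_intros)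
  have lim: "((\<lambda>z. z / (z + 6 * \<i>)) \<longlongrightarrow> 1) at_infinity" "((\<lambda>z. (z - 6 * \<i>) / (z + 6 * \<i>)) \<longlongrightarrow> 1) at_infinity"
    using tendsto_affine_ratio_at_infinity[of 0 "6 * \<i>"] tendsto_affine_ratio_at_infinity[of "- 6 * \<i>" "6 * \<i>"]
    by simp_all
  have lifts1: "lifts upper_patch (\<lambda>z. proj (vector [of_real e * (z + 6 * \<i>), \<i> * z])) v1"
  proof (rule liftsI)
    show nz1: "v1 z \<noteq> 0" for z
      using e0 by (auto simp: v1_def vec_eq_iff forall_2)
    show "proj (vector [of_real e * (z + 6 * \<i>), \<i> * z]) = proj (v1 z)" if "z \<in> upper_patch" for z
      using that nz1[of z] nz[of z] v1[of z] by (auto simp: upper_patch_def intro!: proj_scale[symmetric])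
    show "((\<lambda>z. v1 z $ k) \<longlongrightarrow> (vector [of_real e, \<i> * 1] :: complex^2) $ k) at_infinity" for k
      using exhaust_2[of k] by (elim disjE) (simp_all only: v1_def vector_2 tendsto_const tendsto_mult[OF tendsto_const lim(1)])
  qed (use e0 in \<open>auto simp: upper_patch_def vec_eq_iff forall_2 intro!: c1\<close>)
  have lifts2: "lifts lower_patch (\<lambda>z. proj (?w z)) v2"
  proof (rule liftsI)
    show nz2: "v2 z \<noteq> 0" for z
      using e0 by (auto simp: v2_def vec_eq_iff forall_3)
    show "proj (?w z) = proj (v2 z)" if "z \<in> lower_patch" for z
      using that nz2[of z] nz[of z] v2[of z] by (auto simp: lower_patch_def intro!: proj_scale[symmetric])
    show "((\<lambda>z. v2 z $ k) \<longlongrightarrow> (vector [of_real e, \<i> * 1, of_real e * 1] :: complex^3) $ k) at_infinity" for k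
      using exhaust_3[of k] by (elim disjE) (simp_all only: v2_def vector_3 tendsto_const tendsto_mult[OF tendsto_const lim(1)] tendsto_mult[OF tendsto_const lim(2)])
  qed (use e0 in \<open>auto simp: lower_patch_def vec_eq_iff forall_3 intro!: c2\<close>)
  have "has_loop_degree (\<lambda>x. squared_phase L_AC (v2 (of_real x))) 3"
    unfolding has_loop_degree_def
  proof (intro exI conjI allI)
    \<comment> \<open>The sixth power of \<open>- \<i>\<close> contributes the constant \<open>- \<pi>\<close>.\<close>
    let ?\<theta> = "\<lambda>x. 6 * arctan (x / 6) - pi"
    show "continuous_on UNIV ?\<theta>"
      by (intro continuous_intros) auto
    show "squared_phase L_AC (v2 (of_real x)) (cis (?\<theta> x))" for x
    proof -
      define c where "c = 1 / (complex_of_real x + 6 * \<i>)"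
      have c0: "c \<noteq> 0" using nz[of "of_real x"] by (simp add: c_def)
      have "v2 (of_real x) = c *s ac (of_real (e * x)) (of_real (e * 6)) (of_real (x / sqrt 2))"
        unfolding v2[of "complex_of_real x", simplified] c_def[symmetric]
        by (simp add: vec_eq_iff forall_3 ac_def algebra_simps)
      then have "squared_phase L_AC (v2 (of_real x)) (sgn (c ^ 6))"
        using squared_phase_L_AC[OF c0, of "e * 6" "e * x" "x / sqrt 2"] e0 by simp
      moreover have "sgn (c ^ 6) = cis (?\<theta> x)"
      proof -
        have "36 + x\<^sup>2 > 0" by (simp add: add_pos_nonneg)
        then have "complex_of_real (36 + x\<^sup>2) \<noteq> 0" by (simp only: of_real_eq_0_iff)
        then have "c = of_real (1 / (36 + x\<^sup>2)) * (- \<i> * (6 + \<i> * of_real x))"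
          using c0 unfolding c_def by (simp add: field_simps power2_eq_square)
        then have "sgn c = - \<i> * sgn (6 + \<i> * of_real x)"
          using \<open>36 + x\<^sup>2 > 0\<close>
          by (simp only: sgn_of_real_mult zero_less_divide_1_iff) (simp add: sgn_eq norm_mult)
        also have "\<dots> = cis (- (pi / 2)) * cis (arctan (x / 6))"
          using cis_arctan[of 6 x] by (simp add: cis_minus_pi_half)
        also have "\<dots> = cis (arctan (x / 6) - pi / 2)"
          unfolding cis_mult by simp
        finally have "sgn (c ^ 6) = cis (6 * (arctan (x / 6) - pi / 2))"
          using Complex.DeMoivre[of "arctan (x / 6) - pi / 2" 6] by (simp add: sgn_power_complex)
        also have "6 * (arctan (x / 6) - pi / 2) = ?\<theta> x - 2 * pi"
          by simp
        finally show ?thesis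
          by (metis cis_divide cis_2pi div_by_1)
      qed
      ultimately show ?thesis by simp
    qed
    show "(?\<theta> \<longlongrightarrow> 6 * (- (pi / 2)) - pi) at_bot"
      by (intro tendsto_intros arctan_div_tendsto) simp
    have "(?\<theta> \<longlongrightarrow> 6 * (pi / 2) - pi) at_top"
      by (intro tendsto_intros arctan_div_tendsto) simp
    then show "(?\<theta> \<longlongrightarrow> 6 * (- (pi / 2)) - pi + 2 * pi * of_int 3) at_top"
      by simp
  qed
  moreover have "has_loop_degree (\<lambda>x. squared_phase2 Lambda_S1 (v1 (of_real x + \<i>), v2 (of_real x + \<i>))) 2"
    unfolding has_loop_degree_def
  proof (intro exI conjI allI)
    let ?\<theta> = "\<lambda>x. 2 * arctan (x / 5) + 2 * arctan (x / 7)"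
    show "continuous_on UNIV ?\<theta>"
      by (intro continuous_intros) auto
    show "squared_phase2 Lambda_S1 (v1 (of_real x + \<i>), v2 (of_real x + \<i>)) (cis (?\<theta> x))" for x
    proof -
      define z where "z = complex_of_real x + \<i>"
      define Z where "Z = of_real e * ((z - 6 * \<i>) / (z + 6 * \<i>))"
      have n: "cmod (z + 6 * \<i>) \<noteq> 0"
        using nz[of z] by (simp add: z_def)
      have q: "(cmod (z - 6 * \<i>))\<^sup>2 = x\<^sup>2 + 25" "(cmod z)\<^sup>2 = x\<^sup>2 + 1" "(cmod (z + 6 * \<i>))\<^sup>2 = x\<^sup>2 + 49"
        by (simp_all add: cmod_power2 z_def)
      have "2 * (cmod Z)\<^sup>2 = (cmod (of_real e))\<^sup>2 + (cmod (\<i> * (z / (z + 6 * \<i>))))\<^sup>2"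
        unfolding Z_def norm_mult norm_divide power_mult_distrib power_divide q
        using e add_nonneg_pos[of "x\<^sup>2" 49] by (simp add: divide_simps)
      then have "squared_phase2 Lambda_S1 (v1 z, v2 z) (sgn (Z\<^sup>2))"
        unfolding v1_def v2_def Z_def[symmetric] using e0 by (intro squared_phase2_Lambda_S1) auto
      moreover have "sgn (Z\<^sup>2) = cis (?\<theta> x)"
      proof -
        have p: "x\<^sup>2 + 49 > 0" by (simp add: add_nonneg_pos)
        have zn: "of_real x + 7 * \<i> \<noteq> 0" by (simp add: complex_eq_iff)
        have "complex_of_real (x\<^sup>2 + 49) \<noteq> 0" using p by (simp only: of_real_eq_0_iff)
        then have "Z = of_real (- e / (x\<^sup>2 + 49)) * ((5 + \<i> * of_real x) * (7 + \<i> * of_real x))"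
          using zn unfolding Z_def z_def by (simp add: field_simps power2_eq_square)
        then have "Z\<^sup>2 = of_real ((- e / (x\<^sup>2 + 49))\<^sup>2) * ((5 + \<i> * of_real x) * (7 + \<i> * of_real x))\<^sup>2"
          by (simp only: power_mult_distrib of_real_power)
        moreover have "(- e / (x\<^sup>2 + 49))\<^sup>2 > 0"
          using e0 p by simp
        ultimately have "sgn (Z\<^sup>2) = sgn (((5 + \<i> * of_real x) * (7 + \<i> * of_real x))\<^sup>2)"
          by (simp only: sgn_of_real_mult)
        also have "\<dots> = (cis (arctan (x / 5)) * cis (arctan (x / 7)))\<^sup>2"
          using cis_arctan[of 5 x] cis_arctan[of 7 x] by (simp add: sgn_power_complex sgn_mult)
        also have "\<dots> = cis (?\<theta> x)"
          using Complex.DeMoivre[of "arctan (x / 5) + arctan (x / 7)" 2] by (simp add: cis_mult)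
        finally show ?thesis .
      qed
      ultimately show ?thesis by (simp add: z_def)
    qed
    show "(?\<theta> \<longlongrightarrow> 2 * (- (pi / 2)) + 2 * (- (pi / 2))) at_bot"
      by (intro tendsto_intros arctan_div_tendsto) auto
    have "(?\<theta> \<longlongrightarrow> 2 * (pi / 2) + 2 * (pi / 2)) at_top"
      by (intro tendsto_intros arctan_div_tendsto) auto
    then show "(?\<theta> \<longlongrightarrow> 2 * (- (pi / 2)) + 2 * (- (pi / 2)) + 2 * pi * of_int 2) at_top"
      by simp
  qed
  ultimately show ?thesis
    unfolding has_quilted_maslov_index_def
    by (intro exI[of _ v1] exI[of _ v2] exI[of _ 3] exI[of _ 2]) (simp add: lifts1 lifts2)
qed

section \<open>The quilted disk\<close>

theorem proposition3p2:
  fixes \<epsilon> :: complex and u1 :: "complex \<Rightarrow> cp1" and u2 :: "complex \<Rightarrow> cp2"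
  assumes "\<epsilon> \<in> {1, -1}"
    and "u1 = (\<lambda>z. proj (vector [\<epsilon> * (z + 6 * \<i>), \<i> * z]))"
    and "u2 = (\<lambda>z. proj (vector [\<epsilon> * (z + 6 * \<i>), \<i> * z, \<epsilon> * (z - 6 * \<i>)]))"
  shows "(\<forall>z\<in>upper_patch. (vector [\<epsilon> * (z + 6 * \<i>), \<i> * z] :: complex^2) \<noteq> 0)
    \<and> (\<forall>z\<in>lower_patch. (vector [\<epsilon> * (z + 6 * \<i>), \<i> * z, \<epsilon> * (z - 6 * \<i>)] :: complex^3) \<noteq> 0)
    \<and> cproj_holomorphic_on u1 upper_patch
    \<and> cproj_holomorphic_on u2 lower_patch
    \<and> (\<forall>x::real. (u1 (of_real x + \<i>), u2 (of_real x + \<i>)) \<in> Lambda_S1)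
    \<and> (\<forall>x::real. u2 (of_real x) \<in> L_AC)
    \<and> fs_pullback upper_patch u1 absolutely_integrable_on upper_patch
    \<and> fs_pullback lower_patch u2 absolutely_integrable_on lower_patch
    \<and> symplectic_area upper_patch u1 + symplectic_area lower_patch u2 = cp1_area / 4
    \<and> 2 * (symplectic_area upper_patch u1 + symplectic_area lower_patch u2) = 1
    \<and> has_quilted_maslov_index Lambda_S1 L_AC u1 u2 1"
proof -
  obtain e :: real where e: "\<epsilon> = of_real e" "e\<^sup>2 = 1"
    using assms(1) that[of 1] that[of "-1"] by auto
  have nz1: "(vector [\<epsilon> * (z + 6 * \<i>), \<i> * z] :: complex^2) \<noteq> 0" for z
    using assms(1) by (auto simp: vec_eq_iff forall_2)
  have nz2: "(vector [\<epsilon> * (z + 6 * \<i>), \<i> * z, \<epsilon> * (z - 6 * \<i>)] :: complex^3) \<noteq> 0" for z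
    using assms(1) by (auto simp: vec_eq_iff forall_3)
  have hol1: "cproj_holomorphic_on u1 upper_patch"
    unfolding assms(2)
  proof (rule cproj_holomorphic_on_proj[OF nz1])
    show "(\<lambda>z. (vector [\<epsilon> * (z + 6 * \<i>), \<i> * z] :: complex^2) $ k) holomorphic_on upper_patch" for k
      using exhaust_2[of k] by (elim disjE) (auto intro!: holomorphic_intros)
  qed
  have hol2: "cproj_holomorphic_on u2 lower_patch"
    unfolding assms(3)
  proof (rule cproj_holomorphic_on_proj[OF nz2])
    show "(\<lambda>z. (vector [\<epsilon> * (z + 6 * \<i>), \<i> * z, \<epsilon> * (z - 6 * \<i>)] :: complex^3) $ k)
        holomorphic_on lower_patch" for k
      using exhaust_3[of k] by (elim disjE) (auto intro!: holomorphic_intros)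
  qed
  have seam: "(u1 (of_real x + \<i>), u2 (of_real x + \<i>)) \<in> Lambda_S1" for x
  proof -
    have "2 * (cmod (\<epsilon> * (of_real x + \<i> - 6 * \<i>)))\<^sup>2
        = (cmod (\<epsilon> * (of_real x + \<i> + 6 * \<i>)))\<^sup>2 + (cmod (\<i> * (of_real x + \<i>)))\<^sup>2"
      using e by (simp add: norm_mult power_mult_distrib cmod_power2)
    moreover have "(\<epsilon> * (of_real x + \<i> + 6 * \<i>), \<i> * (of_real x + \<i>)) \<noteq> (0, 0)"
      by (auto simp: complex_eq_iff)
    ultimately show ?thesis
      unfolding assms(2,3)
      using proj_in_Lambda_S1[of 1 1, unfolded vector_smult_lid] one_neq_zero by blast
  qed
  have boundary: "u2 (of_real x) \<in> L_AC" for x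
  proof -
    have "vector [\<epsilon> * (of_real x + 6 * \<i>), \<i> * of_real x, \<epsilon> * (of_real x - 6 * \<i>)]
        = 1 *s ac (of_real (e * x)) (of_real (e * 6)) (of_real (x / sqrt 2))"
      by (simp add: vec_eq_iff forall_3 ac_def e(1) algebra_simps)
    moreover have "e \<noteq> 0"
      using e(2) by auto
    ultimately show ?thesis
      using proj_ac_in_L_AC[of 1 "e * x" "e * 6" "x / sqrt 2"] unfolding assms(3) by simp
  qed
  show ?thesis
    using nz1 nz2 hol1 hol2 seam boundary area_u1[OF e(2)] area_u2[OF e(2)] quilted_maslov_index_u[OF e(2)]
    unfolding cp1_area_eq e(1) assms(2,3) by simp
qed

end
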